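(* Let $H$ be an infinite dimensional separable Hilbert space and $I$ a countable index set. Let $w=\{w_j\}_{j\in I}$ be a Riesz sequence in $H$ with canonical dual $\widetilde w=\{\widetilde w_j\}_{j\in I}$, and let $f=\{f_i\}_{i\in I}$ be a frame for $H$. Suppose $w$ is a weak R-dual of $f$ with respect to Parseval frames $u=\{u_i\}_{i\in I}$ and $v=\{v_i\}_{i\in I}$ for $H$. Let $y=\{y_i\}_{i\in I}$ with $y_i:=\sum_{k\in I}\langle u_k,f_i\rangle\widetilde w_k$. If $\dim(Ker(T_y))=\dim((span\{w_j\})^\perp)$, then $u$ is an orthonormal basis of $H$ and there exists another orthonormal basis $v'=\{v'_i\}_{i\in I}$ of $H$ such that $w$ is an R-dual of $f$ with respect to $u$ and $v'$.
   Context: Inner products are linear in the first variable. A sequence $\{f_i\}_{i\in I}$ in $H$ is a frame for $H$ if there are $0<A\le B<\infty$ with $A\|x\|^2\le\sum_{i}|\langle x,f_i\rangle|^2\le B\|x\|^2$ for all $x\in H$; it is a Parseval frame if one can take $A=B=1$. A sequence $\{w_j\}_{j\in I}$ is a Riesz sequence if there are $0<A\le B<\infty$ with $A\|c\|^2\le\|\sum_j c_jw_j\|^2\le B\|c\|^2$ for all finite scalar sequences $c$ (norm of $c$ in $\ell^2(I)$); every Riesz sequence is a frame sequence, i.e. a frame for its closed linear span. The canonical dual of a frame sequence $w$ is $\widetilde w_j=S_w^{-1}w_j$, where $S_w g=\sum_j\langle g,w_j\rangle w_j$ is the frame operator of $w$ on $\overline{span}\{w_j\}$. $T_y:\ell^2(I)\to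 H$, $T_y(\{c_i\})=\sum_i c_iy_i$, is the synthesis operator of $y$. Dimensions are Hilbert space dimensions (finite or $\infty$; all spaces are separable). For sequences $g,h$ in $H$ indexed by $I$, $G(g,h)$ denotes the matrix $(\langle g_i,h_j\rangle)_{i,j\in I}$, $G(g,h)^t$ its transpose, and $\mathcal I$ the infinite identity matrix. Weak R-dual: let $u,v$ be Parseval frames for $H$ and $f$ a sequence in $H$ such that $\sum_{i\in I}|\langle f_i,u_j\rangle|^2<\infty$ for all $j\in I$ and $(G(v,v)^t-\mathcal I)G(f,u)=\mathbf 0$ (i.e. $\sum_{k}\langle v_k,v_i\rangle\langle f_k,u_j\rangle=\langle f_i,u_j\rangle$ for all $i,j$). Then $w=\{w_j\}_{j\in I}$ given by $w_j=\sum_{i\in I}\langle f_i,u_j\rangle v_i$ is called the weak R-dual of $f$ with respect to $u$ and $v$. R-dual: if $u,v$ are orthonormal bases of $H$ and $f$ is a sequence in $H$ with $\sum_{i}|\langle f_i,u_j\rangle|^2<\infty$ for all $j$, then $w_j=\sum_{i\in I}\langle f_i,u_j\rangle v_i$, $j\in I$, is the R-dual of $f$ with respect to $u$ and $v$. *)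

theory Defs
  imports "HOL-Analysis.Analysis" "HOL-Library.Extended_Nat" "HOL-Library.Function_Algebras"
begin

text \<open>Scalars. By Gelfand--Mazur every \<open>real_normed_field\<close> is (isometrically) the reals or the
  complex numbers, and the axiom \<open>sconj_norm\<close> forces \<open>sconj\<close> to be the usual conjugation there.
  Working over this class treats real and complex Hilbert spaces at once.\<close>

class rc_field = real_normed_field +
  fixes sconj :: "'a \<Rightarrow> 'a"
  assumes sconj_add: "sconj (a + b) = sconj a + sconj b"
    and sconj_mult: "sconj (a * b) = sconj a * sconj b"
    and sconj_sconj: "sconj (sconj a) = a"
    and sconj_norm: "a * sconj a = ((norm a)\<^sup>2) *\<^sub>R 1"

instantiation real :: rc_field
begin
definition sconj_real :: "real \<Rightarrow> real" where "sconj_real a = a"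
instance by standard (auto simp: sconj_real_def power2_eq_square)
end

instantiation complex :: rc_field
begin
definition sconj_complex :: "complex \<Rightarrow> complex" where "sconj_complex a = cnj a"
instance
  by standard (auto simp: sconj_complex_def complex_norm_square scaleR_conv_of_real simp flip: of_real_power)
end

text \<open>The whole type \<open>'h\<close> is the Hilbert space; completeness is part of the sort \<open>banach\<close>, and
  the last assumption says that the norm of the type is the one induced by the inner product
  (hence also positive definiteness).\<close>

locale hilbert_space = vector_space scl
  for scl :: "'k::rc_field \<Rightarrow> 'h::banach \<Rightarrow> 'h" +
  fixes ip :: "'h \<Rightarrow> 'h \<Rightarrow> 'k"
  assumes scale_of_real: "scl (of_real r) x = r *\<^sub>R x"
    and ip_add_left: "ip (x + y) z = ip x z + ip y z"
    and ip_scale_left: "ip (scl a x) y = a * ip x y"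
    and ip_sconj: "ip y x = sconj (ip x y)"
    and ip_self: "ip x x = of_real ((norm x)\<^sup>2)"

text \<open>The following two notions are stated for an arbitrary inner product, as they are used both
  for subspaces of the Hilbert space and for subspaces of \<open>\<ell>\<^sup>2\<close>. A Hilbert basis is a
  maximal orthonormal set.\<close>

definition hilbert_basis :: "('a \<Rightarrow> 'a \<Rightarrow> 'k::rc_field) \<Rightarrow> 'a::zero set \<Rightarrow> 'a set \<Rightarrow> bool"
  where "hilbert_basis ip S B \<longleftrightarrow>
    B \<subseteq> S \<and> (\<forall>a\<in>B. \<forall>b\<in>B. ip a b = (if a = b then 1 else 0)) \<and>
    (\<forall>x\<in>S. (\<forall>b\<in>B. ip x b = 0) \<longrightarrow> x = 0)"

text \<open>Only meant for closed subspaces of Hilbert spaces, where Hilbert bases exist and all have the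
  same cardinality.\<close>

definition hilbert_dim :: "('a \<Rightarrow> 'a \<Rightarrow> 'k::rc_field) \<Rightarrow> 'a::zero set \<Rightarrow> enat"
  where "hilbert_dim ip S =
    (let B = SOME B. hilbert_basis ip S B in if finite B then enat (card B) else \<infinity>)"

definition orth_compl :: "('h \<Rightarrow> 'h \<Rightarrow> 'k::rc_field) \<Rightarrow> 'h set \<Rightarrow> 'h set"
  where "orth_compl ip S = {x. \<forall>s\<in>S. ip x s = 0}"

text \<open>\<open>\<ell>\<^sup>2(I)\<close>; sequences are functions on the ambient index type that vanish outside \<open>I\<close>.\<close>

definition ell2 :: "'i set \<Rightarrow> ('i \<Rightarrow> 'k::rc_field) set"
  where "ell2 I = {c. (\<lambda>i. (norm (c i))\<^sup>2) summable_on I \<and> (\<forall>i. i \<notin> I \<longrightarrow> c i = 0)}"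

definition ell2_ip :: "'i set \<Rightarrow> ('i \<Rightarrow> 'k::rc_field) \<Rightarrow> ('i \<Rightarrow> 'k) \<Rightarrow> 'k"
  where "ell2_ip I c d = (\<Sum>\<^sub>\<infinity>i\<in>I. c i * sconj (d i))"

text \<open>\<open>Ker T\<^sub>y\<close>, written with \<open>has_sum\<close> so that a divergent series never counts as \<open>0\<close>.\<close>

definition ker_synthesis ::
    "('k::rc_field \<Rightarrow> 'h::banach \<Rightarrow> 'h) \<Rightarrow> 'i set \<Rightarrow> ('i \<Rightarrow> 'h) \<Rightarrow> ('i \<Rightarrow> 'k) set"
  where "ker_synthesis scl I y =
    {c \<in> ell2 I. ((\<lambda>i. scl (c i) (y i)) has_sum 0) I}"

definition frame_bounds ::
    "('h::banach \<Rightarrow> 'h \<Rightarrow> 'k::rc_field) \<Rightarrow> 'i set \<Rightarrow> ('i \<Rightarrow> 'h) \<Rightarrow> real \<Rightarrow> real \<Rightarrow> bool"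
  where "frame_bounds ip I f A B \<longleftrightarrow>
    (\<forall>x. (\<lambda>i. (norm (ip x (f i)))\<^sup>2) summable_on I \<and>
         A * (norm x)\<^sup>2 \<le> (\<Sum>\<^sub>\<infinity>i\<in>I. (norm (ip x (f i)))\<^sup>2) \<and>
         (\<Sum>\<^sub>\<infinity>i\<in>I. (norm (ip x (f i)))\<^sup>2) \<le> B * (norm x)\<^sup>2)"

definition is_frame :: "('h::banach \<Rightarrow> 'h \<Rightarrow> 'k::rc_field) \<Rightarrow> 'i set \<Rightarrow> ('i \<Rightarrow> 'h) \<Rightarrow> bool"
  where "is_frame ip I f \<longleftrightarrow> (\<exists>A B. 0 < A \<and> A \<le> B \<and> frame_bounds ip I f A B)"

definition parseval_frame :: "('h::banach \<Rightarrow> 'h \<Rightarrow> 'k::rc_field) \<Rightarrow> 'i set \<Rightarrow> ('i \<Rightarrow> 'h) \<Rightarrow> bool"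
  where "parseval_frame ip I f \<longleftrightarrow> frame_bounds ip I f 1 1"

definition riesz_sequence ::
    "('k::rc_field \<Rightarrow> 'h::banach \<Rightarrow> 'h) \<Rightarrow> 'i set \<Rightarrow> ('i \<Rightarrow> 'h) \<Rightarrow> bool"
  where "riesz_sequence scl I w \<longleftrightarrow>
    (\<exists>A B. 0 < A \<and> A \<le> B \<and>
      (\<forall>F c. finite F \<and> F \<subseteq> I \<longrightarrow>
        A * (\<Sum>j\<in>F. (norm (c j))\<^sup>2) \<le> (norm (\<Sum>j\<in>F. scl (c j) (w j)))\<^sup>2 \<and>
        (norm (\<Sum>j\<in>F. scl (c j) (w j)))\<^sup>2 \<le> B * (\<Sum>j\<in>F. (norm (c j))\<^sup>2)))"

definition closed_span ::
    "('k::rc_field \<Rightarrow> 'h::banach \<Rightarrow> 'h) \<Rightarrow> 'h set \<Rightarrow> 'h set"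
  where "closed_span scl X = closure (module.span scl X)"

definition frame_operator ::
    "('k::rc_field \<Rightarrow> 'h::banach \<Rightarrow> 'h) \<Rightarrow> ('h \<Rightarrow> 'h \<Rightarrow> 'k) \<Rightarrow> 'i set \<Rightarrow> ('i \<Rightarrow> 'h) \<Rightarrow> 'h \<Rightarrow> 'h"
  where "frame_operator scl ip I w g = (\<Sum>\<^sub>\<infinity>j\<in>I. scl (ip g (w j)) (w j))"

text \<open>\<open>S\<^sub>w\<close> is a bijection of the closed span of \<open>w\<close> whenever \<open>w\<close> is a frame sequence.\<close>

definition canonical_dual ::
    "('k::rc_field \<Rightarrow> 'h::banach \<Rightarrow> 'h) \<Rightarrow> ('h \<Rightarrow> 'h \<Rightarrow> 'k) \<Rightarrow> 'i set \<Rightarrow> ('i \<Rightarrow> 'h) \<Rightarrow> 'i \<Rightarrow> 'h"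
  where "canonical_dual scl ip I w j =
    inv_into (closed_span scl (w ` I)) (frame_operator scl ip I w) (w j)"

definition orthonormal_basis ::
    "('k::rc_field \<Rightarrow> 'h::banach \<Rightarrow> 'h) \<Rightarrow> ('h \<Rightarrow> 'h \<Rightarrow> 'k) \<Rightarrow> 'i set \<Rightarrow> ('i \<Rightarrow> 'h) \<Rightarrow> bool"
  where "orthonormal_basis scl ip I e \<longleftrightarrow>
    (\<forall>i\<in>I. \<forall>j\<in>I. ip (e i) (e j) = (if i = j then 1 else 0)) \<and>
    closed_span scl (e ` I) = UNIV"

definition gram :: "('h \<Rightarrow> 'h \<Rightarrow> 'k) \<Rightarrow> ('i \<Rightarrow> 'h) \<Rightarrow> ('i \<Rightarrow> 'h) \<Rightarrow> 'i \<Rightarrow> 'i \<Rightarrow> 'k"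
  where "gram ip g h i j = ip (g i) (h j)"

text \<open>The fourth conjunct is the entrywise form of \<open>(G(v,v)\<^sup>t - \<I>) G(f,u) = 0\<close>.\<close>

definition weak_R_dual ::
    "('k::rc_field \<Rightarrow> 'h::banach \<Rightarrow> 'h) \<Rightarrow> ('h \<Rightarrow> 'h \<Rightarrow> 'k) \<Rightarrow> 'i set \<Rightarrow>
     ('i \<Rightarrow> 'h) \<Rightarrow> ('i \<Rightarrow> 'h) \<Rightarrow> ('i \<Rightarrow> 'h) \<Rightarrow> ('i \<Rightarrow> 'h) \<Rightarrow> bool"
  where "weak_R_dual scl ip I f u v w \<longleftrightarrow>
    parseval_frame ip I u \<and> parseval_frame ip I v \<and>
    (\<forall>j\<in>I. (\<lambda>i. (norm (ip (f i) (u j)))\<^sup>2) summable_on I) \<and>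
    (\<forall>i\<in>I. \<forall>j\<in>I.
      ((\<lambda>k. (gram ip v v k i - (if i = k then 1 else 0)) * gram ip f u k j) has_sum 0) I) \<and>
    (\<forall>j\<in>I. ((\<lambda>i. scl (ip (f i) (u j)) (v i)) has_sum w j) I)"

definition R_dual ::
    "('k::rc_field \<Rightarrow> 'h::banach \<Rightarrow> 'h) \<Rightarrow> ('h \<Rightarrow> 'h \<Rightarrow> 'k) \<Rightarrow> 'i set \<Rightarrow>
     ('i \<Rightarrow> 'h) \<Rightarrow> ('i \<Rightarrow> 'h) \<Rightarrow> ('i \<Rightarrow> 'h) \<Rightarrow> ('i \<Rightarrow> 'h) \<Rightarrow> bool"
  where "R_dual scl ip I f u v w \<longleftrightarrow>
    orthonormal_basis scl ip I u \<and> orthonormal_basis scl ip I v \<and>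
    (\<forall>j\<in>I. (\<lambda>i. (norm (ip (f i) (u j)))\<^sup>2) summable_on I) \<and>
    (\<forall>j\<in>I. ((\<lambda>i. scl (ip (f i) (u j)) (v i)) has_sum w j) I)"

end

theory Submission
  imports Defs
begin

text \<open>Pairing the definition of \<open>w\<close> with \<open>v\<^sub>i\<close> and using the weak R-dual condition gives
  \<open>\<langle>w\<^sub>j, v\<^sub>i\<rangle> = \<langle>f\<^sub>i, u\<^sub>j\<rangle>\<close>. Hence any linear relation among the \<open>u\<^sub>j\<close> passes (with conjugate
  coefficients) to the \<open>w\<^sub>j\<close>; applied to \<open>u\<^sub>i = \<Sum>\<^sub>k \<langle>u\<^sub>i, u\<^sub>k\<rangle> u\<^sub>k\<close> this forces
  \<open>\<langle>u\<^sub>i, u\<^sub>k\<rangle> = \<delta>\<^sub>i\<^sub>k\<close>.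
  Let \<open>V x = \<Sum>\<^sub>i \<langle>x, v\<^sub>i\<rangle> u\<^sub>i\<close>, an isometry of \<open>H\<close>, and let \<open>W\<close> be the closed span of \<open>w\<close>.
  A sequence \<open>c\<close> lies in \<open>Ker T\<^sub>y\<close> iff \<open>\<Sum>\<^sub>i c\<^sub>i u\<^sub>i\<close> is orthogonal to all \<open>V w\<^sub>j\<close>, so the dimension
  hypothesis says that \<open>W\<^sup>\<bottom>\<close> and \<open>(V W)\<^sup>\<bottom>\<close> have the same dimension. Therefore \<open>V\<close> restricted
  to \<open>W\<close> extends to a unitary \<open>U\<close>, and \<open>v'\<^sub>i = U\<^sup>* u\<^sub>i\<close> is the required basis.\<close>

lemma sconj_0 [simp]: "sconj (0::'k::rc_field) = 0"
  using sconj_add[of "0::'k" 0] by simp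

lemma norm_sconj [simp]: "norm (sconj a) = norm (a::'k::rc_field)"
proof (cases "a = 0")
  case False
  have "norm a * norm (sconj a) = norm a * norm a"
    using arg_cong[OF sconj_norm[of a], of norm] by (simp add: norm_mult power2_eq_square)
  then show ?thesis using False by simp
qed simp

lemma sconj_minus: "sconj (- a) = - sconj (a::'k::rc_field)"
  using sconj_add[of a "- a"] by (simp add: eq_neg_iff_add_eq_0 add.commute)

lemma sconj_of_real [simp]: "sconj (of_real r :: 'k::rc_field) = of_real r"
proof -
  have nonneg: "sconj (of_real s :: 'k) = of_real s" if "s \<ge> 0" for s
  proof -
    define a :: 'k where "a = of_real (sqrt s)"
    have "a * sconj a = of_real s"
      using that by (simp add: sconj_norm a_def norm_of_real scaleR_conv_of_real)
    then show ?thesis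
      by (metis sconj_mult sconj_sconj mult.commute)
  qed
  show ?thesis
  proof (cases "r \<ge> 0")
    case False
    then have "sconj (of_real (- r) :: 'k) = of_real (- r)" by (intro nonneg) simp
    then show ?thesis by (simp add: sconj_minus)
  qed (rule nonneg)
qed

lemma mult_sconj: "a * sconj a = of_real ((norm (a::'k::rc_field))\<^sup>2)"
  by (simp add: sconj_norm scaleR_conv_of_real)

lemma summable_on_square_dominated:
  fixes f :: "'i \<Rightarrow> 'h::banach" and g :: "'i \<Rightarrow> real"
  assumes g: "g summable_on A" and g0: "\<And>i. i \<in> A \<Longrightarrow> g i \<ge> 0"
    and dom: "\<And>F. finite F \<Longrightarrow> F \<subseteq> A \<Longrightarrow> (norm (sum f F))\<^sup>2 \<le> C * sum g F"
  shows "f summable_on A"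
proof -
  obtain L where L: "(g has_sum L) A" using g summable_on_def by blast
  define K where "K = max C 1"
  have K: "K > 0" by (simp add: K_def)
  have domK: "(norm (sum f F))\<^sup>2 \<le> K * sum g F" if "finite F" "F \<subseteq> A" for F
  proof -
    have "C * sum g F \<le> K * sum g F"
      by (rule mult_right_mono) (use that g0 in \<open>auto simp: K_def intro!: sum_nonneg\<close>)
    then show ?thesis using dom[OF that] by simp
  qed
  have "\<exists>P. eventually P (finite_subsets_at_top A) \<and>
          (\<forall>F F'. P F \<and> P F' \<longrightarrow> dist (sum f F) (sum f F') < e)" if e: "e > 0" for e
  proof -
    define d where "d = (e/2)\<^sup>2 / K"
    have d: "d > 0" using e K by (simp add: d_def)
    define P where "P F \<longleftrightarrow> finite F \<and> F \<subseteq> A \<and> L - d < sum g F" for F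
    have ev: "eventually P (finite_subsets_at_top A)"
      using order_tendstoD(1)[OF L[unfolded has_sum_def], of "L - d"] d
      unfolding P_def
      by (auto simp: eventually_conj_iff eventually_finite_subsets_at_top_weakI)
    have half: "norm (sum f (F - G)) < e / 2" if "P F" "P G" for F G
    proof -
      have fin: "finite (F \<union> G)" "F \<union> G \<subseteq> A" using that by (auto simp: P_def)
      have "sum g (F \<union> G) \<le> L"
        using finite_sum_le_has_sum[OF L] fin g0 by blast
      moreover have "sum g (F \<union> G) = sum g (F - G) + sum g G"
        using sum.union_disjoint[of "F - G" G g] fin by (simp add: Un_Diff_cancel2 Int_commute)
      ultimately have "sum g (F - G) < d" using that(2) by (simp add: P_def)
      then have "K * sum g (F - G) < (e/2)\<^sup>2" using K by (simp add: d_def field_simps)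
      then have "(norm (sum f (F - G)))\<^sup>2 < (e/2)\<^sup>2"
        using domK[of "F - G"] fin by fastforce
      then show ?thesis by (rule power_less_imp_less_base) (use e in simp)
    qed
    have "dist (sum f F) (sum f G) < e" if "P F" "P G" for F G
    proof -
      have fin: "finite F" "finite G" using that by (auto simp: P_def)
      have "sum f F - sum f G = sum f (F - G) - sum f (G - F)"
        using sum.Int_Diff[OF fin(1), of f G] sum.Int_Diff[OF fin(2), of f F]
        by (simp add: Int_commute)
      then have "dist (sum f F) (sum f G) \<le> norm (sum f (F - G)) + norm (sum f (G - F))"
        by (simp add: dist_norm norm_triangle_ineq4)
      then show ?thesis using half[OF that] half[OF that(2,1)] by simp
    qed
    then show ?thesis using ev by blast
  qed
  then have "cauchy_filter (filtermap (sum f) (finite_subsets_at_top A))"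
    by (simp add: cauchy_filter_metric_filtermap)
  moreover have "complete (UNIV::'h set)"
    by (meson Cauchy_convergent UNIV_I complete_def convergent_def)
  ultimately obtain L' where "(sum f \<longlongrightarrow> L') (finite_subsets_at_top A)"
    using complete_uniform[where S=UNIV] by (force simp add: filterlim_def)
  then show ?thesis
    using summable_on_def has_sum_def by blast
qed

lemma has_sum_diff:
  fixes f g :: "'i \<Rightarrow> 'b::real_normed_vector"
  assumes "(f has_sum a) A" "(g has_sum b) A"
  shows "((\<lambda>i. f i - g i) has_sum a - b) A"
  using has_sum_add[OF assms(1), of "\<lambda>i. - g i" "- b"] assms(2) by (simp add: has_sum_uminus)

context hilbert_space
begin

lemma ip_add_right: "ip x (y + z) = ip x y + ip x z"
  by (metis ip_add_left ip_sconj sconj_add)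

lemma ip_scale_right: "ip x (scl a y) = sconj a * ip x y"
  by (metis ip_scale_left ip_sconj sconj_mult)

lemma ip_zero_left [simp]: "ip 0 y = 0"
  using ip_add_left[of 0 0 y] by simp

lemma ip_zero_right [simp]: "ip x 0 = 0"
  using ip_add_right[of x 0 0] by simp

lemma ip_eq_zero_sym: "ip x y = 0 \<Longrightarrow> ip y x = 0"
  by (metis ip_sconj sconj_0)

lemma norm_ip_sym: "norm (ip x y) = norm (ip y x)"
  by (metis ip_sconj norm_sconj)

lemma ip_self_eq_0 [simp]: "ip x x = 0 \<longleftrightarrow> x = 0"
  by (simp add: ip_self)

lemma norm_scl: "norm (scl a x) = norm a * norm x"
proof -
  have "ip (scl a x) (scl a x) = (a * sconj a) * ip x x"
    by (simp add: ip_scale_left ip_scale_right)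
  then have "(of_real ((norm (scl a x))\<^sup>2) :: 'k) = of_real ((norm a * norm x)\<^sup>2)"
    by (simp add: ip_self mult_sconj power_mult_distrib)
  then have "(norm (scl a x))\<^sup>2 = (norm a * norm x)\<^sup>2" using of_real_eq_iff by blast
  then show ?thesis by (simp add: power2_eq_iff_nonneg)
qed

lemma scl_scaleR: "scl a (r *\<^sub>R x) = r *\<^sub>R scl a x"
  by (simp add: mult.commute flip: scale_of_real)

lemma bounded_linear_scl: "bounded_linear (scl a)"
  by (rule bounded_linear_intro[where K = "norm a"])
     (auto simp: scale_right_distrib scl_scaleR norm_scl)

lemma ip_scaleR_left: "ip (r *\<^sub>R x) y = r *\<^sub>R ip x y"
  by (simp add: ip_scale_left scaleR_conv_of_real flip: scale_of_real)

lemma ip_scaleR_right: "ip x (r *\<^sub>R y) = r *\<^sub>R ip x y"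
  by (simp add: ip_scale_right scaleR_conv_of_real flip: scale_of_real)

lemma ip_minus_left: "ip (- x) y = - ip x y"
  using ip_scaleR_left[of "-1"] by simp

lemma ip_minus_right: "ip x (- y) = - ip x y"
  using ip_scaleR_right[of _ "-1"] by simp

lemma ip_diff_left: "ip (x - y) z = ip x z - ip y z"
  using ip_add_left[of x "- y" z] by (simp add: ip_minus_left)

lemma ip_diff_right: "ip x (y - z) = ip x y - ip x z"
  using ip_add_right[of x y "- z"] by (simp add: ip_minus_right)

lemma ip_sum_left: "ip (sum g F) y = (\<Sum>i\<in>F. ip (g i) y)"
  by (induction F rule: infinite_finite_induct) (auto simp: ip_add_left)

lemma ip_sum_right: "ip x (sum g F) = (\<Sum>i\<in>F. ip x (g i))"
  by (induction F rule: infinite_finite_induct) (auto simp: ip_add_right)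

lemma ip_mult_sym: "ip x y * ip y x = of_real ((norm (ip x y))\<^sup>2)"
  by (metis ip_sconj mult_sconj)

lemma Cauchy_Schwarz: "norm (ip x y) \<le> norm x * norm y"
proof (cases "y = 0")
  case False
  define n where "n = (norm y)\<^sup>2"
  have n: "n > 0" using False by (simp add: n_def)
  have yy: "ip y y = of_real n" by (simp add: ip_self n_def)
  define z where "z = n *\<^sub>R x - scl (ip x y) y"
  have "ip z z = of_real (n\<^sup>2 * (norm x)\<^sup>2) - of_real n * (ip x y * ip y x)
      - of_real n * (ip x y * sconj (ip x y)) + (ip x y * sconj (ip x y)) * of_real n"
    unfolding z_def
    by (simp add: ip_diff_left ip_diff_right ip_scale_left ip_scale_right ip_scaleR_left
        ip_scaleR_right ip_self[of x] yy scaleR_conv_of_real power2_eq_square algebra_simps)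
  also have "\<dots> = of_real (n\<^sup>2 * (norm x)\<^sup>2 - n * (norm (ip x y))\<^sup>2)"
    by (simp add: ip_mult_sym mult_sconj)
  finally have "(norm z)\<^sup>2 = n * (n * (norm x)\<^sup>2 - (norm (ip x y))\<^sup>2)"
    unfolding ip_self of_real_eq_iff by (simp add: power2_eq_square algebra_simps)
  then have "0 \<le> n * (n * (norm x)\<^sup>2 - (norm (ip x y))\<^sup>2)"
    by (metis zero_le_power2)
  then have "(norm (ip x y))\<^sup>2 \<le> (norm x * norm y)\<^sup>2"
    using n by (simp add: zero_le_mult_iff n_def power_mult_distrib mult.commute)
  then show ?thesis by (simp add: power2_le_iff_abs_le)
qed simp

lemma bounded_linear_ip_left: "bounded_linear (\<lambda>x. ip x y)"
  by (rule bounded_linear_intro[where K = "norm y"])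
     (auto simp: ip_add_left ip_scaleR_left Cauchy_Schwarz)

lemma norm_diff_square:
  "of_real ((norm (x - y))\<^sup>2) = ip x x - ip x y - ip y x + ip y y"
  unfolding ip_self[symmetric] by (simp add: ip_diff_left ip_diff_right algebra_simps)

lemma closed_ip_left_0: "closed {x. ip x z = 0}"
  by (intro closed_Collect_eq continuous_intros linear_continuous_on bounded_linear_ip_left)

lemma continuous_ip_left: "continuous_on A (\<lambda>x. ip x y)"
  by (rule linear_continuous_on[OF bounded_linear_ip_left])

subsection \<open>Bessel systems and synthesis\<close>

definition bessel :: "'i set \<Rightarrow> ('i \<Rightarrow> 'h) \<Rightarrow> real \<Rightarrow> bool" where
  "bessel J g B \<longleftrightarrow> 0 \<le> B \<and>
    (\<forall>x F. finite F \<longrightarrow> F \<subseteq> J \<longrightarrow> (\<Sum>i\<in>F. (norm (ip x (g i)))\<^sup>2) \<le> B * (norm x)\<^sup>2)"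

lemma besselD:
  "bessel J g B \<Longrightarrow> finite F \<Longrightarrow> F \<subseteq> J \<Longrightarrow> (\<Sum>i\<in>F. (norm (ip x (g i)))\<^sup>2) \<le> B * (norm x)\<^sup>2"
  by (auto simp: bessel_def)

lemma norm_sum_scl_ip:
  "(norm (ip (\<Sum>i\<in>F. scl (c i) (g i)) x))\<^sup>2
    \<le> (\<Sum>i\<in>F. (norm (c i))\<^sup>2) * (\<Sum>i\<in>F. (norm (ip x (g i)))\<^sup>2)"
proof -
  have "norm (ip (\<Sum>i\<in>F. scl (c i) (g i)) x) \<le> (\<Sum>i\<in>F. norm (c i) * norm (ip x (g i)))"
    unfolding ip_sum_left
    by (rule sum_norm_le) (simp add: ip_scale_left norm_mult norm_ip_sym[of x])
  then have "(norm (ip (\<Sum>i\<in>F. scl (c i) (g i)) x))\<^sup>2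
      \<le> (\<Sum>i\<in>F. norm (c i) * norm (ip x (g i)))\<^sup>2"
    by (rule power_mono) simp
  also have "\<dots> \<le> (\<Sum>i\<in>F. (norm (c i))\<^sup>2) * (\<Sum>i\<in>F. (norm (ip x (g i)))\<^sup>2)"
    by (rule Cauchy_Schwarz_ineq_sum)
  finally show ?thesis .
qed

lemma bessel_synthesis_bound:
  assumes "bessel J g B" "finite F" "F \<subseteq> J"
  shows "(norm (\<Sum>i\<in>F. scl (c i) (g i)))\<^sup>2 \<le> B * (\<Sum>i\<in>F. (norm (c i))\<^sup>2)"
proof -
  define s where "s = (\<Sum>i\<in>F. scl (c i) (g i))"
  define C where "C = (\<Sum>i\<in>F. (norm (c i))\<^sup>2)"
  have C: "C \<ge> 0" by (simp add: C_def sum_nonneg)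
  have "(norm (ip s s))\<^sup>2 \<le> C * (B * (norm s)\<^sup>2)"
    using norm_sum_scl_ip[of c g F s] mult_left_mono[OF besselD[OF assms, of s] C]
    by (simp add: s_def C_def)
  then have *: "(norm s)\<^sup>2 * (norm s)\<^sup>2 \<le> (norm s)\<^sup>2 * (B * C)"
    by (simp add: ip_self norm_mult power2_eq_square algebra_simps)
  show ?thesis
  proof (cases "s = 0")
    case True
    then show ?thesis using assms(1) by (simp add: s_def bessel_def sum_nonneg)
  next
    case False
    then have "(norm s)\<^sup>2 > 0" by simp
    then have "(norm s)\<^sup>2 \<le> B * C" using * mult_le_cancel_left_pos by blast
    then show ?thesis by (simp add: s_def C_def)
  qed
qed


lemma summable_on_square_bounded:
  assumes "0 \<le> C" "\<And>F. finite F \<Longrightarrow> F \<subseteq> J \<Longrightarrow> (\<Sum>i\<in>F. (norm (c i))\<^sup>2) \<le> C"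
  shows "(\<lambda>i. (norm (c i))\<^sup>2) summable_on J"
  by (rule nonneg_bdd_above_summable_on) (use assms(2) in \<open>auto intro!: bdd_aboveI[of _ C]\<close>)

lemma bessel_coeff_summable: "bessel J g B \<Longrightarrow> (\<lambda>i. (norm (ip x (g i)))\<^sup>2) summable_on J"
  by (rule summable_on_square_bounded[of "B * (norm x)\<^sup>2"]) (auto simp: bessel_def)

lemma bessel_synthesis_summable:
  assumes "bessel J g B" "(\<lambda>i. (norm (c i))\<^sup>2) summable_on J"
  shows "(\<lambda>i. scl (c i) (g i)) summable_on J"
  by (rule summable_on_square_dominated[OF assms(2)]) (use bessel_synthesis_bound[OF assms(1)] in auto)

lemma has_sum_ip_left: "(g has_sum s) J \<Longrightarrow> ((\<lambda>i. ip (g i) y) has_sum ip s y) J"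
  by (rule has_sum_bounded_linear[OF bounded_linear_ip_left])

lemma ip_sum_coeff:
  "ip (\<Sum>i\<in>F. scl (ip x (g i)) (g i)) x = of_real (\<Sum>i\<in>F. (norm (ip x (g i)))\<^sup>2)"
  by (simp add: ip_sum_left ip_scale_left ip_mult_sym)

lemma synthesis_bound_bessel:
  assumes "0 \<le> B"
    and bd: "\<And>c F. finite F \<Longrightarrow> F \<subseteq> J \<Longrightarrow>
      (norm (\<Sum>i\<in>F. scl (c i) (g i)))\<^sup>2 \<le> B * (\<Sum>i\<in>F. (norm (c i))\<^sup>2)"
  shows "bessel J g B"
  unfolding bessel_def
proof (intro conjI allI impI)
  fix x F assume F: "finite F" "F \<subseteq> J"
  define s where "s = (\<Sum>i\<in>F. scl (ip x (g i)) (g i))"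
  define S where "S = (\<Sum>i\<in>F. (norm (ip x (g i)))\<^sup>2)"
  have S: "S \<ge> 0" by (simp add: S_def sum_nonneg)
  have "norm (ip s x) = S"
    using S unfolding s_def ip_sum_coeff S_def[symmetric] by (simp only: norm_of_real abs_of_nonneg)
  then have "S \<le> norm s * norm x" using Cauchy_Schwarz[of s x] by simp
  then have "S\<^sup>2 \<le> (norm s)\<^sup>2 * (norm x)\<^sup>2"
    using S by (metis power_mono power_mult_distrib)
  also have "\<dots> \<le> (B * S) * (norm x)\<^sup>2"
    using bd[OF F] by (intro mult_right_mono) (auto simp: s_def S_def)
  finally have *: "S * S \<le> S * (B * (norm x)\<^sup>2)" by (simp add: power2_eq_square algebra_simps)
  show "S \<le> B * (norm x)\<^sup>2"
  proof (cases "S = 0")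
    case False
    then have "S > 0" using S by simp
    then show ?thesis using * mult_le_cancel_left_pos by blast
  qed (use assms(1) in simp)
qed (rule assms(1))

definition orthonormal :: "'i set \<Rightarrow> ('i \<Rightarrow> 'h) \<Rightarrow> bool" where
  "orthonormal J b \<longleftrightarrow> (\<forall>i\<in>J. \<forall>j\<in>J. ip (b i) (b j) = (if i = j then 1 else 0))"

lemma orthonormal_bessel:
  assumes "orthonormal J b"
  shows "bessel J b 1"
proof (rule synthesis_bound_bessel)
  fix c F assume F: "finite F" "F \<subseteq> J"
  define s where "s = (\<Sum>i\<in>F. scl (c i) (b i))"
  have "ip (b i) s = sconj (c i)" if "i \<in> F" for i
  proof -
    have "ip (b i) s = (\<Sum>j\<in>F. if i = j then sconj (c j) else 0)"
      unfolding s_def ip_sum_right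
      by (rule sum.cong) (use assms F that in \<open>auto simp: ip_scale_right orthonormal_def subset_iff\<close>)
    then show ?thesis using F that by simp
  qed
  then have "ip s s = of_real (\<Sum>i\<in>F. (norm (c i))\<^sup>2)"
    by (subst s_def) (simp add: ip_sum_left ip_scale_left mult_sconj)
  then show "(norm s)\<^sup>2 \<le> 1 * (\<Sum>i\<in>F. (norm (c i))\<^sup>2)"
    unfolding ip_self of_real_eq_iff by simp
qed simp

definition reconstructs :: "'i set \<Rightarrow> ('i \<Rightarrow> 'h) \<Rightarrow> bool" where
  "reconstructs J a \<longleftrightarrow> (\<forall>x. ((\<lambda>i. scl (ip x (a i)) (a i)) has_sum x) J)"

lemma parseval_frame_bessel:
  assumes "parseval_frame ip J a"
  shows "bessel J a 1"
  unfolding bessel_def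
proof (intro conjI allI impI)
  fix x F assume "finite F" "F \<subseteq> J"
  then have "(\<Sum>i\<in>F. (norm (ip x (a i)))\<^sup>2) \<le> (\<Sum>\<^sub>\<infinity>i\<in>J. (norm (ip x (a i)))\<^sup>2)"
    using assms by (intro finite_sum_le_infsum) (auto simp: parseval_frame_def frame_bounds_def)
  also have "\<dots> \<le> 1 * (norm x)\<^sup>2"
    using assms by (simp add: parseval_frame_def frame_bounds_def)
  finally show "(\<Sum>i\<in>F. (norm (ip x (a i)))\<^sup>2) \<le> 1 * (norm x)\<^sup>2" .
qed simp

lemma parseval_frame_reconstructs:
  assumes "parseval_frame ip J a"
  shows "reconstructs J a"
  unfolding reconstructs_def
proof
  fix x
  note b = parseval_frame_bessel[OF assms]
  have "(\<Sum>\<^sub>\<infinity>i\<in>J. (norm (ip x (a i)))\<^sup>2) = (norm x)\<^sup>2"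
    "(\<lambda>i. (norm (ip x (a i)))\<^sup>2) summable_on J"
    using assms[unfolded parseval_frame_def frame_bounds_def, rule_format, of x] by auto
  then have total: "((\<lambda>i. (norm (ip x (a i)))\<^sup>2) has_sum (norm x)\<^sup>2) J"
    by (simp add: has_sum_iff)
  obtain s where s: "((\<lambda>i. scl (ip x (a i)) (a i)) has_sum s) J"
    using bessel_synthesis_summable[OF b bessel_coeff_summable[OF b]] summable_on_def by blast
  have "((\<lambda>i. of_real ((norm (ip x (a i)))\<^sup>2) :: 'k) has_sum ip s x) J"
    using has_sum_ip_left[OF s, of x] by (simp only: ip_scale_left ip_mult_sym)
  then have sx: "ip s x = of_real ((norm x)\<^sup>2)"
    using total has_sum_of_real has_sum_unique by blast
  have "((\<lambda>F. (norm (\<Sum>i\<in>F. scl (ip x (a i)) (a i)))\<^sup>2) \<longlongrightarrow> (norm s)\<^sup>2) (finite_subsets_at_top J)"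
    using s unfolding has_sum_def by (intro tendsto_intros)
  then have "(norm s)\<^sup>2 \<le> (norm x)\<^sup>2"
  proof (rule tendsto_upperbound)
    have "(norm (\<Sum>i\<in>F. scl (ip x (a i)) (a i)))\<^sup>2 \<le> (norm x)\<^sup>2" if "finite F" "F \<subseteq> J" for F
      using bessel_synthesis_bound[OF b that, of "\<lambda>i. ip x (a i)"] besselD[OF b that, of x]
      by linarith
    then show "\<forall>\<^sub>F F in finite_subsets_at_top J. (norm (\<Sum>i\<in>F. scl (ip x (a i)) (a i)))\<^sup>2 \<le> (norm x)\<^sup>2"
      by (intro eventually_finite_subsets_at_top_weakI) auto
  qed simp
  moreover have "of_real ((norm (s - x))\<^sup>2) = (of_real ((norm s)\<^sup>2 - (norm x)\<^sup>2) :: 'k)"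
    using sx ip_sconj[of x s] by (simp add: norm_diff_square ip_self del: of_real_power)
  then have "(norm (s - x))\<^sup>2 = (norm s)\<^sup>2 - (norm x)\<^sup>2" using of_real_eq_iff by blast
  ultimately have "(norm (s - x))\<^sup>2 \<le> 0" by simp
  then have "s = x" by simp
  then show "((\<lambda>i. scl (ip x (a i)) (a i)) has_sum x) J" using s by simp
qed

lemma reconstructs_ip:
  "reconstructs J a \<Longrightarrow> ((\<lambda>i. ip x (a i) * ip (a i) y) has_sum ip x y) J"
  unfolding reconstructs_def using has_sum_ip_left[of "\<lambda>i. scl (ip x (a i)) (a i)" J x y]
  by (simp add: ip_scale_left)

definition transfer :: "'i set \<Rightarrow> ('i \<Rightarrow> 'h) \<Rightarrow> ('i \<Rightarrow> 'h) \<Rightarrow> 'h \<Rightarrow> 'h" where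
  "transfer J a b x = (\<Sum>\<^sub>\<infinity>i\<in>J. scl (ip x (a i)) (b i))"

lemma transfer_has_sum:
  assumes "bessel J a B" "bessel J b C"
  shows "((\<lambda>i. scl (ip x (a i)) (b i)) has_sum transfer J a b x) J"
  unfolding transfer_def
  by (intro has_sum_infsum bessel_synthesis_summable[OF assms(2)] bessel_coeff_summable[OF assms(1)])

lemma orthonormal_coeff:
  assumes "orthonormal J b" "((\<lambda>i. scl (c i) (b i)) has_sum s) J" "k \<in> J"
  shows "ip s (b k) = c k"
proof -
  have "((\<lambda>i. c i * ip (b i) (b k)) has_sum ip s (b k)) J"
    using has_sum_ip_left[OF assms(2), of "b k"] by (simp add: ip_scale_left)
  moreover have "((\<lambda>i. c i * ip (b i) (b k)) has_sum c k) J"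
    by (rule has_sum_finite_neutralI[of "{k}"]) (use assms in \<open>auto simp: orthonormal_def\<close>)
  ultimately show ?thesis using has_sum_unique by blast
qed

lemma transfer_coeff:
  assumes "bessel J a B" "orthonormal J b" "k \<in> J"
  shows "ip (transfer J a b x) (b k) = ip x (a k)"
  using orthonormal_coeff[OF assms(2) transfer_has_sum[OF assms(1) orthonormal_bessel[OF assms(2)]] assms(3)] .

lemma transfer_ip:
  assumes "reconstructs J a" "bessel J a B" "orthonormal J b"
  shows "ip (transfer J a b x) (transfer J a b y) = ip x y"
proof -
  have "((\<lambda>i. ip x (a i) * ip (b i) (transfer J a b y)) has_sum ip (transfer J a b x) (transfer J a b y)) J"
    using has_sum_ip_left[OF transfer_has_sum[OF assms(2) orthonormal_bessel[OF assms(3)]], of x]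
    by (simp add: ip_scale_left)
  moreover have "ip (b i) (transfer J a b y) = ip (a i) y" if "i \<in> J" for i
    using transfer_coeff[OF assms(2,3) that, of y] by (metis ip_sconj)
  ultimately have "((\<lambda>i. ip x (a i) * ip (a i) y) has_sum ip (transfer J a b x) (transfer J a b y)) J"
    by (simp cong: has_sum_cong)
  then show ?thesis using reconstructs_ip[OF assms(1)] has_sum_unique by blast
qed

lemma transfer_add:
  assumes "bessel J a B" "bessel J b C"
  shows "transfer J a b (x + y) = transfer J a b x + transfer J a b y"
  using has_sum_add[OF transfer_has_sum[OF assms] transfer_has_sum[OF assms], of x y]
  unfolding transfer_def[of _ _ _ "x + y"]
  by (simp add: infsumI ip_add_left scale_left_distrib)

lemma transfer_scl:
  assumes "bessel J a B" "bessel J b C"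
  shows "transfer J a b (scl c x) = scl c (transfer J a b x)"
  using has_sum_bounded_linear[OF bounded_linear_scl transfer_has_sum[OF assms], of c x]
  unfolding transfer_def[of _ _ _ "scl c x"]
  by (simp add: infsumI ip_scale_left)

lemma transfer_bounded_linear:
  assumes "reconstructs J a" "bessel J a B" "orthonormal J b"
  shows "bounded_linear (transfer J a b)"
proof (rule bounded_linear_intro[where K = 1])
  note bb = orthonormal_bessel[OF assms(3)]
  show "transfer J a b (x + y) = transfer J a b x + transfer J a b y" for x y
    by (rule transfer_add[OF assms(2) bb])
  show "transfer J a b (r *\<^sub>R x) = r *\<^sub>R transfer J a b x" for r x
    using transfer_scl[OF assms(2) bb, of "of_real r" x] by (simp add: scale_of_real)
  show "norm (transfer J a b x) \<le> norm x * 1" for x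
  proof -
    have "(norm (transfer J a b x))\<^sup>2 = (norm x)\<^sup>2"
      using transfer_ip[OF assms, of x x] unfolding ip_self of_real_eq_iff .
    then show ?thesis by simp
  qed
qed

subsection \<open>Closed subspaces and orthonormal expansions\<close>

lemma has_sum_in_closed_subspace:
  assumes "closed S" "subspace S" "\<And>i. i \<in> J \<Longrightarrow> g i \<in> S" "(g has_sum s) J"
  shows "s \<in> S"
proof (rule Lim_in_closed_set[OF assms(1)])
  show "(sum g \<longlongrightarrow> s) (finite_subsets_at_top J)" using assms(4) by (simp add: has_sum_def)
  show "\<forall>\<^sub>F F in finite_subsets_at_top J. sum g F \<in> S"
    by (intro eventually_finite_subsets_at_top_weakI subspace_sum[OF assms(2)]) (use assms(3) in auto)
qed simp

lemma closed_closed_span: "closed (closed_span scl X)"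
  by (simp add: closed_span_def)

lemma subspace_closed_span: "subspace (closed_span scl X)"
  unfolding closed_span_def
proof (rule subspaceI)
  show "0 \<in> closure (span X)" using closure_subset span_zero by (rule subsetD)
next
  fix x y assume "x \<in> closure (span X)" "y \<in> closure (span X)"
  then obtain p q where "\<And>n. p n \<in> span X" "p \<longlonglongrightarrow> x" "\<And>n. q n \<in> span X" "q \<longlonglongrightarrow> y"
    by (auto simp: closure_sequential)
  then have "(\<lambda>n. p n + q n) \<longlonglongrightarrow> x + y" "\<And>n. p n + q n \<in> span X"
    by (auto intro: tendsto_add span_add)
  then show "x + y \<in> closure (span X)"
    unfolding closure_sequential by (intro exI[of _ "\<lambda>n. p n + q n"]) simp
next
  fix c x assume "x \<in> closure (span X)"
  then obtain p where p: "\<And>n. p n \<in> span X" "p \<longlonglongrightarrow> x" by (auto simp: closure_sequential)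
  have "(\<lambda>n. scl c (p n)) \<longlonglongrightarrow> scl c x"
    by (rule bounded_linear.tendsto[OF bounded_linear_scl p(2)])
  then show "scl c x \<in> closure (span X)"
    unfolding closure_sequential using p(1)
    by (intro exI[of _ "\<lambda>n. scl c (p n)"]) (simp add: span_scale)
qed

lemma closed_span_superset: "X \<subseteq> closed_span scl X"
  unfolding closed_span_def using closure_subset span_superset by blast

lemma closed_span_minimal:
  "X \<subseteq> S \<Longrightarrow> closed S \<Longrightarrow> subspace S \<Longrightarrow> closed_span scl X \<subseteq> S"
  unfolding closed_span_def by (intro closure_minimal span_minimal)

lemma subspace_ip_0: "subspace {x. ip x z = 0}"
  by (rule subspaceI) (auto simp: ip_add_left ip_scale_left)

lemma closed_span_ip_0:
  assumes "\<And>x. x \<in> X \<Longrightarrow> ip x z = 0" "x \<in> closed_span scl X"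
  shows "ip x z = 0"
  using closed_span_minimal[of X "{x. ip x z = 0}"] assms closed_ip_left_0 subspace_ip_0 by auto

lemma orthonormal_expansion:
  assumes S: "closed S" "subspace S" and b: "orthonormal J b" "b ` J \<subseteq> S"
    and complete: "\<And>x. x \<in> S \<Longrightarrow> (\<And>j. j \<in> J \<Longrightarrow> ip x (b j) = 0) \<Longrightarrow> x = 0"
    and x: "x \<in> S"
  shows "((\<lambda>j. scl (ip x (b j)) (b j)) has_sum x) J"
proof -
  note bb = orthonormal_bessel[OF b(1)]
  define s where "s = transfer J b b x"
  have s: "((\<lambda>j. scl (ip x (b j)) (b j)) has_sum s) J"
    unfolding s_def by (rule transfer_has_sum[OF bb bb])
  have "s \<in> S"
    by (rule has_sum_in_closed_subspace[OF S _ s]) (use b(2) S(2) in \<open>auto intro: subspace_scale\<close>)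
  then have "x - s \<in> S" using x S(2) subspace_diff by blast
  moreover have "ip (x - s) (b j) = 0" if "j \<in> J" for j
    using transfer_coeff[OF bb b(1) that, of x] by (simp add: ip_diff_left s_def)
  ultimately have "x - s = 0" by (rule complete)
  then show ?thesis using s by simp
qed

lemma orthonormal_complete_reconstructs:
  assumes "orthonormal J b" "\<And>x. (\<And>j. j \<in> J \<Longrightarrow> ip x (b j) = 0) \<Longrightarrow> x = 0"
  shows "reconstructs J b"
  unfolding reconstructs_def
proof
  fix x
  show "((\<lambda>j. scl (ip x (b j)) (b j)) has_sum x) J"
  proof (rule orthonormal_expansion[where S = UNIV])
    show "y = 0" if "\<And>j. j \<in> J \<Longrightarrow> ip y (b j) = 0" for y by (rule assms(2)) (rule that)
  qed (simp_all add: assms(1))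
qed

lemma hilbert_basis_exists:
  assumes S: "subspace S"
  shows "\<exists>B. hilbert_basis ip S B"
proof -
  define \<A> where "\<A> = {B. B \<subseteq> S \<and> orthonormal B (\<lambda>x. x)}"
  have "\<exists>M\<in>\<A>. \<forall>X\<in>\<A>. M \<subseteq> X \<longrightarrow> X = M"
  proof (rule subset_Zorn_nonempty)
    have "{} \<in> \<A>" by (simp add: \<A>_def orthonormal_def)
    then show "\<A> \<noteq> {}" by blast
    fix C assume C: "C \<noteq> {}" "subset.chain \<A> C"
    have "ip a b = (if a = b then 1 else 0)" if ab: "a \<in> \<Union>C" "b \<in> \<Union>C" for a b
    proof -
      obtain X Y where XY: "a \<in> X" "X \<in> C" "b \<in> Y" "Y \<in> C" using ab by blast
      then have "X \<subseteq> Y \<or> Y \<subseteq> X" using C(2) by (auto simp: subset_chain_def)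
      then obtain Z where "Z \<in> C" "a \<in> Z" "b \<in> Z" using XY by blast
      moreover have "orthonormal Z (\<lambda>x. x)"
        using C(2) \<open>Z \<in> C\<close> by (auto simp: subset_chain_def \<A>_def)
      ultimately show ?thesis by (simp add: orthonormal_def)
    qed
    moreover have "\<Union>C \<subseteq> S" using C(2) by (auto simp: subset_chain_def \<A>_def)
    ultimately show "\<Union>C \<in> \<A>" unfolding \<A>_def orthonormal_def by simp
  qed
  then obtain M where "M \<in> \<A>" and max: "\<And>X. X \<in> \<A> \<Longrightarrow> M \<subseteq> X \<Longrightarrow> X = M" by blast
  then have M: "M \<subseteq> S" "orthonormal M (\<lambda>x. x)" by (auto simp: \<A>_def)
  have "x = 0" if x: "x \<in> S" "\<forall>b\<in>M. ip x b = 0" for x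
  proof (rule ccontr)
    assume x0: "x \<noteq> 0"
    define t where "t = inverse (norm x) *\<^sub>R x"
    have "t \<in> S" unfolding t_def using subspace_scale[OF S x(1), of "of_real (inverse (norm x))"]
      by (simp only: scale_of_real)
    have tt: "ip t t = 1" using x0 unfolding ip_self by (simp add: t_def)
    have tb: "ip t b = 0 \<and> ip b t = 0" if "b \<in> M" for b
      using x(2) that ip_eq_zero_sym[of x b] by (simp add: t_def ip_scaleR_left ip_scaleR_right)
    have "t \<notin> M" using tb tt by fastforce
    moreover have "insert t M \<in> \<A>"
      using M(1,2) \<open>t \<in> S\<close> tt tb \<open>t \<notin> M\<close> unfolding \<A>_def orthonormal_def by auto
    ultimately show False using max[of "insert t M"] by blast
  qed
  then show ?thesis using M(1,2) unfolding hilbert_basis_def orthonormal_def by blast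
qed

lemma countable_orthonormal:
  assumes D: "countable D" "closure D = (UNIV::'h set)" and B: "orthonormal B (\<lambda>x. x)"
  shows "countable B"
proof -
  have "\<exists>d\<in>D. dist d b < 1/2" for b
    using D(2) closure_approachable[THEN iffD1, rule_format, of b D "1/2"] by simp
  then obtain d where d: "\<And>b. d b \<in> D" "\<And>b. dist (d b) b < 1/2" by metis
  have "inj_on d B"
  proof (rule inj_onI, rule ccontr)
    fix a b assume ab: "a \<in> B" "b \<in> B" "d a = d b" "a \<noteq> b"
    have "dist a b \<le> dist (d a) a + dist (d a) b" by (rule dist_triangle3)
    then have "norm (a - b) < 1" using d(2)[of a] d(2)[of b] ab(3) by (simp add: dist_norm)
    moreover have "of_real ((norm (a - b))\<^sup>2) = (of_real 2 :: 'k)"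
      using B ab unfolding norm_diff_square orthonormal_def by simp
    then have "(norm (a - b))\<^sup>2 = 2" using of_real_eq_iff by blast
    ultimately show False using power_le_one[of "norm (a - b)" 2] by simp
  qed
  moreover have "countable (d ` B)" using countable_subset[OF _ D(1)] d(1) by blast
  ultimately show ?thesis using countable_image_inj_on by blast
qed


lemma projection_exists:
  assumes S: "closed S" "subspace S"
  shows "\<exists>p\<in>S. \<forall>s\<in>S. ip s (x - p) = 0"
proof -
  obtain B where B: "hilbert_basis ip S B" using hilbert_basis_exists[OF S(2)] by blast
  have BS: "B \<subseteq> S" and ob: "orthonormal B (\<lambda>b. b)"
    and complete: "\<And>s. s \<in> S \<Longrightarrow> (\<And>b. b \<in> B \<Longrightarrow> ip s b = 0) \<Longrightarrow> s = 0"
    using B by (auto simp: hilbert_basis_def orthonormal_def)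
  note bb = orthonormal_bessel[OF ob]
  define p where "p = transfer B (\<lambda>b. b) (\<lambda>b. b) x"
  have "p \<in> S"
    by (rule has_sum_in_closed_subspace[OF S _ transfer_has_sum[OF bb bb, of x, folded p_def]])
       (use BS S(2) in \<open>auto intro: subspace_scale\<close>)
  moreover have "ip s (x - p) = 0" if s: "s \<in> S" for s
  proof -
    have sum: "((\<lambda>b. scl (ip s b) b) has_sum s) B"
      by (rule orthonormal_expansion[OF S ob _ _ s]) (use BS complete in auto)
    have "ip b (x - p) = 0" if "b \<in> B" for b
      using transfer_coeff[OF bb ob that, of x] ip_eq_zero_sym[of "x - p" b]
      by (simp add: ip_diff_left p_def)
    then have "((\<lambda>b. 0) has_sum ip s (x - p)) B"
      using has_sum_ip_left[OF sum, of "x - p"] by (simp add: ip_scale_left cong: has_sum_cong)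
    then show ?thesis using has_sum_0_simp has_sum_unique by blast
  qed
  ultimately show ?thesis by blast
qed

lemma span_image_obtains_sum:
  assumes "z \<in> span (w ` K)"
  obtains F c where "finite F" "F \<subseteq> K" "z = (\<Sum>k\<in>F. scl (c k) (w k))"
proof -
  obtain t r where t: "finite t" "t \<subseteq> w ` K" "z = (\<Sum>a\<in>t. scl (r a) a)"
    using assms unfolding span_explicit by blast
  then obtain F where F: "F \<subseteq> K" "inj_on w F" "t = w ` F"
    using subset_image_inj[of t w K] by auto
  have "finite F" using F t(1) by (simp add: finite_image_iff)
  moreover have "z = (\<Sum>k\<in>F. scl (r (w k)) (w k))"
    using t(3) F by (simp add: sum.reindex)
  ultimately show ?thesis using F(1) by (intro that[of F "\<lambda>k. r (w k)"])
qed

lemma closed_span_mono: "X \<subseteq> Y \<Longrightarrow> closed_span scl X \<subseteq> closed_span scl Y"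
  unfolding closed_span_def by (intro closure_mono span_mono)

lemma orthonormal_basis_iff:
  "orthonormal_basis scl ip I e \<longleftrightarrow> orthonormal I e \<and> closed_span scl (e ` I) = UNIV"
  by (simp add: orthonormal_basis_def orthonormal_def)

lemma closed_span_UNIV_if_has_sum:
  assumes "\<And>x. \<exists>c. ((\<lambda>i. scl (c i) (e i)) has_sum x) I"
  shows "closed_span scl (e ` I) = UNIV"
proof -
  have "x \<in> closed_span scl (e ` I)" for x
  proof -
    obtain c where "((\<lambda>i. scl (c i) (e i)) has_sum x) I" using assms by blast
    then show ?thesis
      by (rule has_sum_in_closed_subspace[OF closed_closed_span subspace_closed_span, rotated])
         (use subspace_scale[OF subspace_closed_span] closed_span_superset in blast)
  qed
  then show ?thesis by blast
qed

lemma reconstructs_orthonormal_basis: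
  "orthonormal I e \<Longrightarrow> reconstructs I e \<Longrightarrow> orthonormal_basis scl ip I e"
  unfolding orthonormal_basis_iff
  by (auto simp: reconstructs_def intro!: closed_span_UNIV_if_has_sum)

text \<open>An isometry \<open>V\<close> defined on \<open>W\<close> extends to a unitary as soon as a Hilbert basis of \<open>W\<^sup>\<bottom>\<close>
  can be matched with one of \<open>(V W)\<^sup>\<bottom>\<close>; \<open>v'\<close> is the preimage of the orthonormal basis \<open>u\<close>.\<close>

lemma unitary_extension:
  assumes W: "closed W" "subspace W"
    and V: "bounded_linear V" "\<And>c x. V (scl c x) = scl c (V x)" "\<And>x y. ip (V x) (V y) = ip x y"
    and B: "hilbert_basis ip (orth_compl ip W) B"
    and psi: "orthonormal B \<psi>" "\<And>x b. x \<in> W \<Longrightarrow> b \<in> B \<Longrightarrow> ip (V x) (\<psi> b) = 0"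
    and complete: "\<And>z. (\<And>x. x \<in> W \<Longrightarrow> ip (V x) z = 0) \<Longrightarrow> (\<And>b. b \<in> B \<Longrightarrow> ip z (\<psi> b) = 0) \<Longrightarrow> z = 0"
    and u: "orthonormal I u" "reconstructs I u"
  shows "\<exists>v'. orthonormal_basis scl ip I v' \<and>
    (\<forall>x\<in>W. ((\<lambda>i. scl (ip (V x) (u i)) (v' i)) has_sum x) I)"
proof -
  obtain E where E: "hilbert_basis ip W E" using hilbert_basis_exists[OF W(2)] by blast
  have EW: "E \<subseteq> W" and oE: "orthonormal E (\<lambda>b. b)"
    and cE: "\<And>s. s \<in> W \<Longrightarrow> (\<And>b. b \<in> E \<Longrightarrow> ip s b = 0) \<Longrightarrow> s = 0"
    using E by (auto simp: hilbert_basis_def orthonormal_def)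
  have BW: "B \<subseteq> orth_compl ip W" and oB: "orthonormal B (\<lambda>b. b)"
    and cB: "\<And>s. s \<in> orth_compl ip W \<Longrightarrow> (\<And>b. b \<in> B \<Longrightarrow> ip s b = 0) \<Longrightarrow> s = 0"
    using B by (auto simp: hilbert_basis_def orthonormal_def)
  have expand: "((\<lambda>e. scl (ip x e) e) has_sum x) E" if "x \<in> W" for x
    by (rule orthonormal_expansion[OF W oE _ _ that]) (use EW cE in auto)
  have expandV: "((\<lambda>e. scl (ip x e) (V e)) has_sum V x) E" if "x \<in> W" for x
    using has_sum_bounded_linear[OF V(1) expand[OF that]] by (simp add: V(2))
  have BE: "ip b e = 0" "ip e b = 0" if "b \<in> B" "e \<in> E" for b e
    using BW EW that ip_eq_zero_sym[of b e] by (auto simp: orth_compl_def)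
  have disj: "b \<notin> E" if "b \<in> B" for b
    using BE(1)[of b b] oB that unfolding orthonormal_def by force
  define J where "J = E \<union> B"
  define \<phi> where "\<phi> e = (if e \<in> E then V e else \<psi> e)" for e
  have Vpsi: "ip (V e) (\<psi> b) = 0" "ip (\<psi> b) (V e) = 0" if "e \<in> E" "b \<in> B" for e b
    using psi(2)[of e b] that EW ip_eq_zero_sym[of "V e" "\<psi> b"] by auto
  have oJ: "orthonormal J (\<lambda>b. b)"
    unfolding orthonormal_def
  proof (intro ballI)
    fix a b assume "a \<in> J" "b \<in> J"
    then consider "a \<in> E" "b \<in> E" | "a \<in> E" "b \<in> B" | "a \<in> B" "b \<in> E" | "a \<in> B" "b \<in> B"
      unfolding J_def by blast
    then show "ip a b = (if a = b then 1 else 0)"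
      by cases (use oE oB BE disj in \<open>auto simp: orthonormal_def\<close>)
  qed
  have ophi: "orthonormal J \<phi>"
    unfolding orthonormal_def
  proof (intro ballI)
    fix a b assume "a \<in> J" "b \<in> J"
    then consider "a \<in> E" "b \<in> E" | "a \<in> E" "b \<in> B" | "a \<in> B" "b \<in> E" | "a \<in> B" "b \<in> B"
      unfolding J_def by blast
    then show "ip (\<phi> a) (\<phi> b) = (if a = b then 1 else 0)"
    proof cases
      case 1 then show ?thesis using oE by (simp add: \<phi>_def V(3) orthonormal_def)
    next
      case 2 then show ?thesis using disj Vpsi by (auto simp: \<phi>_def)
    next
      case 3 then show ?thesis using disj Vpsi by (auto simp: \<phi>_def)
    next
      case 4 then show ?thesis using disj psi(1) by (simp add: \<phi>_def orthonormal_def)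
    qed
  qed
  have zero_sum: "ip s z = 0" if "((\<lambda>e. scl (c e) (h e)) has_sum s) E" "\<And>e. e \<in> E \<Longrightarrow> ip (h e) z = 0" for c h s z
  proof -
    have "((\<lambda>e. 0) has_sum ip s z) E"
      using has_sum_ip_left[OF that(1), of z] that(2) by (simp add: ip_scale_left cong: has_sum_cong)
    then show ?thesis using has_sum_0_simp has_sum_unique by blast
  qed
  have recJ: "reconstructs J (\<lambda>b. b)"
  proof (rule orthonormal_complete_reconstructs[OF oJ])
    fix z assume z: "\<And>e. e \<in> J \<Longrightarrow> ip z e = 0"
    have "ip x z = 0" if "x \<in> W" for x
      by (rule zero_sum[OF expand[OF that]]) (rule ip_eq_zero_sym, rule z, simp add: J_def)
    then have "z \<in> orth_compl ip W" unfolding orth_compl_def using ip_eq_zero_sym by blast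
    then show "z = 0" by (rule cB) (rule z, simp add: J_def)
  qed
  have recphi: "reconstructs J \<phi>"
  proof (rule orthonormal_complete_reconstructs[OF ophi])
    fix z assume z: "\<And>e. e \<in> J \<Longrightarrow> ip z (\<phi> e) = 0"
    have zE: "ip (V e) z = 0" if "e \<in> E" for e
      using z[of e] that ip_eq_zero_sym[of z "V e"] by (simp add: \<phi>_def J_def)
    show "z = 0"
    proof (rule complete)
      show "ip (V x) z = 0" if "x \<in> W" for x
        by (rule zero_sum[OF expandV[OF that]]) (rule zE)
      show "ip z (\<psi> b) = 0" if "b \<in> B" for b
        using z[of b] that disj[of b] by (simp add: \<phi>_def J_def)
    qed
  qed
  note bJ = orthonormal_bessel[OF oJ] and bphi = orthonormal_bessel[OF ophi]
  define U where "U = transfer J \<phi> (\<lambda>b. b)"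
  have U_lin: "bounded_linear U" unfolding U_def by (rule transfer_bounded_linear[OF recphi bphi oJ])
  have U_scl: "U (scl c x) = scl c (U x)" for c x unfolding U_def by (rule transfer_scl[OF bphi bJ])
  have U_ip: "ip (U x) (U y) = ip x y" for x y unfolding U_def by (rule transfer_ip[OF recphi bphi oJ])
  have U_phi: "U (\<phi> e) = e" if "e \<in> J" for e
  proof -
    have "((\<lambda>a. scl (ip (\<phi> e) (\<phi> a)) a) has_sum e) J"
      by (rule has_sum_finite_neutralI[of "{e}"]) (use ophi that in \<open>auto simp: orthonormal_def\<close>)
    then show ?thesis unfolding U_def transfer_def by (rule infsumI)
  qed
  have U_surj: "\<exists>z. U z = x" for x
  proof -
    have "((\<lambda>e. scl (ip x e) (U (\<phi> e))) has_sum U (transfer J (\<lambda>b. b) \<phi> x)) J"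
      using has_sum_bounded_linear[OF U_lin transfer_has_sum[OF bJ bphi, of x]] by (simp add: U_scl)
    then have "((\<lambda>e. scl (ip x e) e) has_sum U (transfer J (\<lambda>b. b) \<phi> x)) J"
      by (simp add: U_phi cong: has_sum_cong)
    then show ?thesis using recJ has_sum_unique unfolding reconstructs_def by blast
  qed
  have UV: "U (V x) = x" if "x \<in> W" for x
  proof -
    have "((\<lambda>e. scl (ip x e) (U (V e))) has_sum U (V x)) E"
      using has_sum_bounded_linear[OF U_lin expandV[OF that]] by (simp add: U_scl)
    moreover have "U (V e) = e" if "e \<in> E" for e
      using U_phi[of e] that by (simp add: J_def \<phi>_def)
    ultimately have "((\<lambda>e. scl (ip x e) e) has_sum U (V x)) E"
      by (simp cong: has_sum_cong)
    then show ?thesis using expand[OF that] has_sum_unique by blast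
  qed
  have Uu: "((\<lambda>i. scl (ip z (u i)) (U (u i))) has_sum U z) I" for z
    using has_sum_bounded_linear[OF U_lin u(2)[unfolded reconstructs_def, rule_format, of z]]
    by (simp add: U_scl)
  have "orthonormal_basis scl ip I (\<lambda>i. U (u i))"
    unfolding orthonormal_basis_iff
  proof
    show "orthonormal I (\<lambda>i. U (u i))" using u(1) by (simp add: orthonormal_def U_ip)
    show "closed_span scl ((\<lambda>i. U (u i)) ` I) = UNIV"
      by (rule closed_span_UNIV_if_has_sum) (metis Uu U_surj)
  qed
  moreover have "((\<lambda>i. scl (ip (V x) (u i)) (U (u i))) has_sum x) I" if "x \<in> W" for x
    using Uu[of "V x"] UV[OF that] by simp
  ultimately show ?thesis by blast
qed

end

subsection \<open>Riesz sequences and their canonical duals\<close>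

locale riesz_system = hilbert_space scl ip
  for scl :: "'k::rc_field \<Rightarrow> 'h::banach \<Rightarrow> 'h" and ip :: "'h \<Rightarrow> 'h \<Rightarrow> 'k" +
  fixes I :: "'i set" and w :: "'i \<Rightarrow> 'h" and A B :: real
  assumes A_pos: "0 < A" and B_nonneg: "0 \<le> B"
    and lower: "\<And>F c. finite F \<Longrightarrow> F \<subseteq> I \<Longrightarrow>
      A * (\<Sum>j\<in>F. (norm (c j))\<^sup>2) \<le> (norm (\<Sum>j\<in>F. scl (c j) (w j)))\<^sup>2"
    and upper: "\<And>F c. finite F \<Longrightarrow> F \<subseteq> I \<Longrightarrow>
      (norm (\<Sum>j\<in>F. scl (c j) (w j)))\<^sup>2 \<le> B * (\<Sum>j\<in>F. (norm (c j))\<^sup>2)"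
begin

abbreviation W :: "'h set" where "W \<equiv> closed_span scl (w ` I)"

lemma bessel_w: "bessel I w B"
  by (rule synthesis_bound_bessel[OF B_nonneg upper])

lemma w_in_W: "i \<in> I \<Longrightarrow> w i \<in> W"
  by (rule subsetD[OF closed_span_superset imageI])

lemma W_eq_0:
  assumes "s \<in> W" "\<And>j. j \<in> I \<Longrightarrow> ip s (w j) = 0"
  shows "s = 0"
proof -
  have "ip s s = 0"
    by (rule closed_span_ip_0[OF _ assms(1)]) (use assms(2) ip_eq_zero_sym in blast)
  then show ?thesis by simp
qed

lemma coeff_eq_0:
  assumes "((\<lambda>i. scl (c i) (w i)) has_sum 0) I" "j \<in> I"
  shows "c j = 0"
proof -
  have "((\<lambda>F. (norm (\<Sum>i\<in>F. scl (c i) (w i)))\<^sup>2) \<longlongrightarrow> (norm (0::'h))\<^sup>2) (finite_subsets_at_top I)"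
    using assms(1) unfolding has_sum_def by (intro tendsto_intros)
  moreover have "\<forall>\<^sub>F F in finite_subsets_at_top I. A * (norm (c j))\<^sup>2 \<le> (norm (\<Sum>i\<in>F. scl (c i) (w i)))\<^sup>2"
    unfolding eventually_finite_subsets_at_top
  proof (intro exI[of _ "{j}"] conjI allI impI)
    fix F assume F: "finite F \<and> {j} \<subseteq> F \<and> F \<subseteq> I"
    have "(norm (c j))\<^sup>2 \<le> (\<Sum>i\<in>F. (norm (c i))\<^sup>2)"
      by (rule member_le_sum) (use F in auto)
    then have "A * (norm (c j))\<^sup>2 \<le> A * (\<Sum>i\<in>F. (norm (c i))\<^sup>2)"
      using A_pos by simp
    also have "\<dots> \<le> (norm (\<Sum>i\<in>F. scl (c i) (w i)))\<^sup>2" by (rule lower) (use F in auto)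
    finally show "A * (norm (c j))\<^sup>2 \<le> (norm (\<Sum>i\<in>F. scl (c i) (w i)))\<^sup>2" .
  qed (use assms(2) in auto)
  ultimately have "A * (norm (c j))\<^sup>2 \<le> (norm (0::'h))\<^sup>2"
    by (rule tendsto_lowerbound) simp
  then show ?thesis using A_pos by (simp add: mult_le_0_iff)
qed

lemma lower_frame_bound:
  assumes "s \<in> W" and bd: "\<And>F. finite F \<Longrightarrow> F \<subseteq> I \<Longrightarrow> (\<Sum>i\<in>F. (norm (ip s (w i)))\<^sup>2) \<le> C"
  shows "A * (norm s)\<^sup>2 \<le> C"
proof -
  have "A * (norm (ip z s))\<^sup>2 \<le> C * (norm z)\<^sup>2" if z: "z \<in> span (w ` I)" for z
  proof -
    obtain F c where F: "finite F" "F \<subseteq> I" "z = (\<Sum>k\<in>F. scl (c k) (w k))"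
      using span_image_obtains_sum[OF z] by metis
    define S where "S = (\<Sum>k\<in>F. (norm (c k))\<^sup>2)"
    have S: "S \<ge> 0" by (simp add: S_def sum_nonneg)
    have C: "C \<ge> 0" using bd[of "{}"] by simp
    have "(norm (ip z s))\<^sup>2 \<le> S * C"
      using norm_sum_scl_ip[of c w F s] mult_left_mono[OF bd[OF F(1,2)] S]
      unfolding F(3) S_def by linarith
    then have "A * (norm (ip z s))\<^sup>2 \<le> C * (A * S)"
      using A_pos by (simp add: mult.commute mult.left_commute)
    also have "\<dots> \<le> C * (norm z)\<^sup>2"
      using lower[OF F(1,2), of c] C unfolding F(3) S_def by (rule mult_left_mono)
    finally show ?thesis .
  qed
  then have sub: "span (w ` I) \<subseteq> {z. A * (norm (ip z s))\<^sup>2 \<le> C * (norm z)\<^sup>2}" by blast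
  have "closed {z. A * (norm (ip z s))\<^sup>2 \<le> C * (norm z)\<^sup>2}"
    by (intro closed_Collect_le continuous_intros continuous_ip_left)
  from closure_minimal[OF sub this] have "A * (norm (ip s s))\<^sup>2 \<le> C * (norm s)\<^sup>2"
    using assms(1) unfolding closed_span_def by blast
  then have *: "(norm s)\<^sup>2 * (A * (norm s)\<^sup>2) \<le> (norm s)\<^sup>2 * C"
    by (simp add: ip_self norm_mult power2_eq_square algebra_simps)
  show ?thesis
  proof (cases "s = 0")
    case True
    then show ?thesis using bd[of "{}"] by simp
  next
    case False
    then have "(norm s)\<^sup>2 > 0" by simp
    then show ?thesis using * mult_le_cancel_left_pos by blast
  qed
qed

lemma not_in_span_others:
  assumes j: "j \<in> I"
  shows "w j \<notin> closed_span scl (w ` (I - {j}))"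
proof
  assume "w j \<in> closed_span scl (w ` (I - {j}))"
  then obtain z where z: "z \<in> span (w ` (I - {j}))" "dist z (w j) < sqrt A"
    unfolding closed_span_def closure_approachable using A_pos by (meson real_sqrt_gt_zero)
  obtain F c where F: "finite F" "F \<subseteq> I - {j}" "z = (\<Sum>k\<in>F. scl (c k) (w k))"
    using span_image_obtains_sum[OF z(1)] by metis
  define c' where "c' k = (if k = j then 1 else - c k)" for k
  have jF: "j \<notin> F" using F(2) by blast
  have eq: "(\<Sum>k\<in>F. scl (c' k) (w k)) = - z"
    unfolding F(3) sum_negf[symmetric]
    by (rule sum.cong) (use jF in \<open>auto simp: c'_def scale_minus_left\<close>)
  have "A * 1 \<le> A * (\<Sum>k\<in>insert j F. (norm (c' k))\<^sup>2)"
    using F(1) jF A_pos by (intro mult_left_mono) (auto simp: c'_def sum_nonneg)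
  also have "\<dots> \<le> (norm (\<Sum>k\<in>insert j F. scl (c' k) (w k)))\<^sup>2"
    by (rule lower) (use F j in auto)
  also have "(\<Sum>k\<in>insert j F. scl (c' k) (w k)) = w j - z"
    using F(1) jF eq by (simp add: c'_def)
  also have "(norm (w j - z))\<^sup>2 = (dist z (w j))\<^sup>2" by (simp add: dist_norm norm_minus_commute)
  also have "\<dots> < (sqrt A)\<^sup>2" using z(2) by (intro power_strict_mono) auto
  finally show False using A_pos by simp
qed

lemma biorthogonal_exists:
  assumes j: "j \<in> I"
  shows "\<exists>g\<in>W. \<forall>k\<in>I. ip g (w k) = (if j = k then 1 else 0)"
proof -
  let ?M = "closed_span scl (w ` (I - {j}))"
  obtain p where p: "p \<in> ?M" "\<And>s. s \<in> ?M \<Longrightarrow> ip s (w j - p) = 0"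
    using projection_exists[OF closed_closed_span subspace_closed_span] by blast
  define g where "g = w j - p"
  have g0: "g \<noteq> 0" using not_in_span_others[OF j] p(1) by (auto simp: g_def)
  have pW: "p \<in> W" using p(1) closed_span_mono[of "w ` (I - {j})" "w ` I"] by blast
  have gW: "g \<in> W"
    unfolding g_def by (rule subspace_diff[OF subspace_closed_span w_in_W[OF j] pW])
  define n where "n = (norm g)\<^sup>2"
  have n: "n \<noteq> 0" using g0 by (simp add: n_def)
  have "ip g p = 0" using p ip_eq_zero_sym unfolding g_def by blast
  then have gj: "ip g (w j) = of_real n"
    using ip_diff_right[of g "w j" p] ip_self[of g] by (simp add: g_def n_def)
  have gk: "ip g (w k) = 0" if "k \<in> I" "k \<noteq> j" for k
  proof (rule ip_eq_zero_sym)
    show "ip (w k) g = 0" unfolding g_def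
      by (rule p(2)) (use that closed_span_superset[of "w ` (I - {j})"] in blast)
  qed
  have "inverse n *\<^sub>R g \<in> W"
    using subspace_scale[OF subspace_closed_span gW, of "of_real (inverse n)"]
    by (simp only: scale_of_real)
  moreover have "ip (inverse n *\<^sub>R g) (w k) = (if j = k then 1 else 0)" if "k \<in> I" for k
    using gj gk[OF that] n by (auto simp: ip_scaleR_left scaleR_conv_of_real)
  ultimately show ?thesis by blast
qed

lemma canonical_dual_biorthogonal:
  assumes j: "j \<in> I"
  shows "canonical_dual scl ip I w j \<in> W"
    and "k \<in> I \<Longrightarrow> ip (canonical_dual scl ip I w j) (w k) = (if j = k then 1 else 0)"
proof -
  let ?S = "frame_operator scl ip I w" and ?d = "canonical_dual scl ip I w j"
  have S: "((\<lambda>k. scl (ip g (w k)) (w k)) has_sum ?S g) I" for g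
    using transfer_has_sum[OF bessel_w bessel_w] by (simp add: transfer_def frame_operator_def)
  obtain g where g: "g \<in> W" "\<And>k. k \<in> I \<Longrightarrow> ip g (w k) = (if j = k then 1 else 0)"
    using biorthogonal_exists[OF j] by blast
  have delta: "((\<lambda>k. scl (if j = k then 1 else 0) (w k)) has_sum w j) I"
    by (rule has_sum_finite_neutralI[of "{j}"]) (use j in auto)
  have "((\<lambda>k. scl (if j = k then 1 else 0) (w k)) has_sum ?S g) I"
    using S[of g] g(2) by (simp cong: has_sum_cong)
  then have "?S g = w j" using delta has_sum_unique by blast
  then have im: "w j \<in> ?S ` W" using g(1) image_eqI[of "w j" ?S g W] by simp
  show "?d \<in> W" unfolding canonical_dual_def by (rule inv_into_into[OF im])
  have "?S ?d = w j" unfolding canonical_dual_def by (rule f_inv_into_f[OF im])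
  then have "((\<lambda>k. scl (ip ?d (w k)) (w k)) has_sum w j) I" using S[of ?d] by simp
  from has_sum_diff[OF this delta]
  have "((\<lambda>k. scl (ip ?d (w k) - (if j = k then 1 else 0)) (w k)) has_sum 0) I"
    by (simp add: scale_left_diff_distrib)
  from coeff_eq_0[OF this]
  show "ip ?d (w k) = (if j = k then 1 else 0)" if "k \<in> I"
    using that by (simp only: eq_iff_diff_eq_0[symmetric])
qed

lemma bessel_canonical_dual: "bessel I (canonical_dual scl ip I w) (1 / A)"
proof (rule synthesis_bound_bessel)
  let ?d = "canonical_dual scl ip I w"
  fix c F assume F: "finite F" "F \<subseteq> I"
  define s where "s = (\<Sum>i\<in>F. scl (c i) (?d i))"
  have "s \<in> W" unfolding s_def
    by (intro subspace_sum subspace_scale subspace_closed_span canonical_dual_biorthogonal(1))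
       (use F in auto)
  then have "A * (norm s)\<^sup>2 \<le> (\<Sum>i\<in>F. (norm (c i))\<^sup>2)"
  proof (rule lower_frame_bound)
    fix G assume G: "finite G" "G \<subseteq> I"
    have coeff: "ip s (w k) = (if k \<in> F then c k else 0)" if "k \<in> I" for k
    proof -
      have "ip s (w k) = (\<Sum>i\<in>F. if i = k then c i else 0)"
        unfolding s_def ip_sum_left
        by (rule sum.cong) (use F that in \<open>auto simp: ip_scale_left canonical_dual_biorthogonal(2)\<close>)
      then show ?thesis using F by simp
    qed
    have "(\<Sum>i\<in>G. (norm (ip s (w i)))\<^sup>2) = (\<Sum>i\<in>G. if i \<in> F then (norm (c i))\<^sup>2 else 0)"
      by (rule sum.cong) (use coeff G in auto)
    also have "\<dots> = (\<Sum>i\<in>G \<inter> F. (norm (c i))\<^sup>2)"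
      using G(1) by (simp add: sum.inter_restrict)
    also have "\<dots> \<le> (\<Sum>i\<in>F. (norm (c i))\<^sup>2)" by (rule sum_mono2) (use F in auto)
    finally show "(\<Sum>i\<in>G. (norm (ip s (w i)))\<^sup>2) \<le> (\<Sum>i\<in>F. (norm (c i))\<^sup>2)" .
  qed
  then show "(norm s)\<^sup>2 \<le> 1 / A * (\<Sum>i\<in>F. (norm (c i))\<^sup>2)"
    using A_pos by (simp add: field_simps)
qed (use A_pos in simp)

end

locale riesz_dual_system = riesz_system scl ip I w A B
  for scl :: "'k::rc_field \<Rightarrow> 'h::banach \<Rightarrow> 'h" and ip :: "'h \<Rightarrow> 'h \<Rightarrow> 'k"
    and I :: "'i set" and w :: "'i \<Rightarrow> 'h" and A B :: real +
  fixes f u y :: "'i \<Rightarrow> 'h" and C :: real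
  assumes f: "bessel I f C" and u: "bessel I u 1"
    and y: "\<And>i. i \<in> I \<Longrightarrow>
      y i = (\<Sum>\<^sub>\<infinity>k\<in>I. scl (ip (u k) (f i)) (canonical_dual scl ip I w k))"
begin

lemma y_has_sum:
  assumes "i \<in> I"
  shows "((\<lambda>k. scl (ip (u k) (f i)) (canonical_dual scl ip I w k)) has_sum y i) I"
proof -
  have "(\<lambda>k. (norm (ip (u k) (f i)))\<^sup>2) summable_on I"
    using bessel_coeff_summable[OF u, of "f i"] by (simp add: norm_ip_sym[of "u _"])
  from bessel_synthesis_summable[OF bessel_canonical_dual this]
  show ?thesis unfolding y[OF assms] by (rule has_sum_infsum)
qed

lemma y_in_W: "i \<in> I \<Longrightarrow> y i \<in> W"
  by (rule has_sum_in_closed_subspace[OF closed_closed_span subspace_closed_span _ y_has_sum])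
     (intro subspace_scale[OF subspace_closed_span] canonical_dual_biorthogonal(1))

lemma ip_y_w:
  assumes "i \<in> I" "j \<in> I"
  shows "ip (y i) (w j) = ip (u j) (f i)"
proof -
  have "((\<lambda>k. ip (u k) (f i) * ip (canonical_dual scl ip I w k) (w j)) has_sum ip (y i) (w j)) I"
    using has_sum_ip_left[OF y_has_sum[OF assms(1)]] by (simp add: ip_scale_left)
  moreover have "((\<lambda>k. ip (u k) (f i) * ip (canonical_dual scl ip I w k) (w j)) has_sum ip (u j) (f i)) I"
    by (rule has_sum_finite_neutralI[of "{j}"])
       (use assms in \<open>auto simp: canonical_dual_biorthogonal(2)\<close>)
  ultimately show ?thesis using has_sum_unique by blast
qed

lemma bessel_y: "bessel I y (C / A)"
proof (rule synthesis_bound_bessel)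
  show "0 \<le> C / A" using f A_pos by (simp add: bessel_def)
  fix c F assume F: "finite F" "F \<subseteq> I"
  define s where "s = (\<Sum>i\<in>F. scl (c i) (y i))"
  define x where "x = (\<Sum>i\<in>F. scl (sconj (c i)) (f i))"
  have "s \<in> W" unfolding s_def
    by (intro subspace_sum subspace_scale subspace_closed_span y_in_W) (use F in auto)
  then have "A * (norm s)\<^sup>2 \<le> C * (\<Sum>i\<in>F. (norm (c i))\<^sup>2)"
  proof (rule lower_frame_bound)
    fix G assume G: "finite G" "G \<subseteq> I"
    have coeff: "ip s (w k) = ip (u k) x" if "k \<in> I" for k
      unfolding s_def x_def ip_sum_left ip_sum_right
      by (rule sum.cong) (use F that in \<open>auto simp: ip_scale_left ip_scale_right sconj_sconj ip_y_w\<close>)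
    have "(\<Sum>i\<in>G. (norm (ip s (w i)))\<^sup>2) = (\<Sum>i\<in>G. (norm (ip x (u i)))\<^sup>2)"
      by (rule sum.cong) (use coeff G norm_ip_sym[of x] in auto)
    also have "\<dots> \<le> (norm x)\<^sup>2" using besselD[OF u G, of x] by simp
    also have "\<dots> \<le> C * (\<Sum>i\<in>F. (norm (c i))\<^sup>2)"
      using bessel_synthesis_bound[OF f F, of "\<lambda>i. sconj (c i)"] by (simp add: x_def)
    finally show "(\<Sum>i\<in>G. (norm (ip s (w i)))\<^sup>2) \<le> C * (\<Sum>i\<in>F. (norm (c i))\<^sup>2)" .
  qed
  then show "(norm s)\<^sup>2 \<le> C / A * (\<Sum>i\<in>F. (norm (c i))\<^sup>2)"
    using A_pos by (simp add: field_simps)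
qed

lemma ker_synthesis_iff:
  "c \<in> ker_synthesis scl I y \<longleftrightarrow>
    c \<in> ell2 I \<and> (\<forall>j\<in>I. ((\<lambda>i. c i * ip (u j) (f i)) has_sum 0) I)"
proof (cases "c \<in> ell2 I")
  case True
  then have "(\<lambda>i. (norm (c i))\<^sup>2) summable_on I" by (simp add: ell2_def)
  then obtain s where s: "((\<lambda>i. scl (c i) (y i)) has_sum s) I"
    using bessel_synthesis_summable[OF bessel_y] summable_on_def by blast
  have sW: "s \<in> W"
    by (rule has_sum_in_closed_subspace[OF closed_closed_span subspace_closed_span _ s])
       (intro subspace_scale[OF subspace_closed_span] y_in_W)
  have coeff: "((\<lambda>i. c i * ip (u j) (f i)) has_sum ip s (w j)) I" if "j \<in> I" for j
    using has_sum_ip_left[OF s, of "w j"] that by (simp add: ip_scale_left ip_y_w cong: has_sum_cong)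
  have "((\<lambda>i. scl (c i) (y i)) has_sum 0) I \<longleftrightarrow> s = 0"
    using s has_sum_unique by blast
  also have "\<dots> \<longleftrightarrow> (\<forall>j\<in>I. ip s (w j) = 0)" using W_eq_0[OF sW] by auto
  also have "\<dots> \<longleftrightarrow> (\<forall>j\<in>I. ((\<lambda>i. c i * ip (u j) (f i)) has_sum 0) I)"
    using coeff has_sum_unique by metis
  finally show ?thesis using True by (simp add: ker_synthesis_def)
qed (simp add: ker_synthesis_def)

end

subsection \<open>Weak R-duals\<close>

lemma ex_bij_betw_if_enat_card_eq:
  assumes "(if finite S then enat (card S) else \<infinity>) = (if finite T then enat (card T) else \<infinity>)"
    and "countable S" "countable T"
  shows "\<exists>h. bij_betw h S T"
proof (cases "finite S")
  case True
  then have "finite T" "card S = card T" using assms(1) by (auto split: if_splits)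
  then show ?thesis using True finite_same_card_bij by blast
next
  case False
  then have "infinite T" using assms(1) by (auto split: if_splits)
  then show ?thesis
    using bij_betw_trans[OF to_nat_on_infinite[OF assms(2) False] bij_betw_from_nat_into[OF assms(3)]]
    by blast
qed

context hilbert_space
begin

definition synthesis :: "'i set \<Rightarrow> ('i \<Rightarrow> 'h) \<Rightarrow> ('i \<Rightarrow> 'k) \<Rightarrow> 'h" where
  "synthesis I u c = (\<Sum>\<^sub>\<infinity>i\<in>I. scl (c i) (u i))"

definition analysis :: "'i set \<Rightarrow> ('i \<Rightarrow> 'h) \<Rightarrow> 'h \<Rightarrow> 'i \<Rightarrow> 'k" where
  "analysis I u x i = (if i \<in> I then ip x (u i) else 0)"

lemma synthesis_has_sum:
  "bessel I u C \<Longrightarrow> c \<in> ell2 I \<Longrightarrow> ((\<lambda>i. scl (c i) (u i)) has_sum synthesis I u c) I"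
  unfolding synthesis_def ell2_def by (intro has_sum_infsum bessel_synthesis_summable) auto

lemma analysis_in_ell2: "bessel I u C \<Longrightarrow> analysis I u x \<in> ell2 I"
  using bessel_coeff_summable[of I u C x]
  by (auto simp: ell2_def analysis_def cong: summable_on_cong)

lemma synthesis_analysis: "reconstructs I u \<Longrightarrow> synthesis I u (analysis I u x) = x"
  unfolding synthesis_def reconstructs_def by (simp add: analysis_def infsumI cong: infsum_cong)

lemma analysis_synthesis:
  assumes "orthonormal I u" "c \<in> ell2 I"
  shows "analysis I u (synthesis I u c) = c"
proof
  fix i
  show "analysis I u (synthesis I u c) i = c i"
    using orthonormal_coeff[OF assms(1) synthesis_has_sum[OF orthonormal_bessel[OF assms(1)] assms(2)], of i]
      assms(2)
    by (auto simp: analysis_def ell2_def)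
qed

lemma ell2_ip_analysis:
  assumes "reconstructs I u"
  shows "ell2_ip I (analysis I u x) (analysis I u z) = ip x z"
proof -
  have "((\<lambda>i. analysis I u x i * sconj (analysis I u z i)) has_sum ip x z) I"
    using reconstructs_ip[OF assms, of x z] ip_sconj[of _ z, symmetric]
    by (simp add: analysis_def cong: has_sum_cong)
  then show ?thesis unfolding ell2_ip_def by (rule infsumI)
qed

lemma ell2_ip_synthesis:
  assumes "orthonormal I u" "reconstructs I u" "c \<in> ell2 I" "d \<in> ell2 I"
  shows "ip (synthesis I u c) (synthesis I u d) = ell2_ip I c d"
  using ell2_ip_analysis[OF assms(2), of "synthesis I u c" "synthesis I u d"]
  by (simp add: analysis_synthesis assms)

text \<open>Under the isometry \<open>\<ell>\<^sup>2(I) \<cong> H\<close> given by an orthonormal basis, a Hilbert basis of a subspace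
  of \<open>\<ell>\<^sup>2(I)\<close> becomes an orthonormal family in \<open>H\<close>, so completeness of \<open>\<ell>\<^sup>2(I)\<close> is not needed.\<close>

lemma hilbert_basis_ell2_exists:
  fixes u :: "'i \<Rightarrow> 'h"
  assumes u: "orthonormal I u" "reconstructs I u"
    and K: "subspace K" and N: "\<And>c. c \<in> N \<longleftrightarrow> c \<in> ell2 I \<and> synthesis I u c \<in> K"
  shows "\<exists>S. hilbert_basis (ell2_ip I) N S"
proof -
  obtain B where B: "B \<subseteq> K" "orthonormal B (\<lambda>b. b)"
    "\<And>x. x \<in> K \<Longrightarrow> (\<And>b. b \<in> B \<Longrightarrow> ip x b = 0) \<Longrightarrow> x = 0"
    using hilbert_basis_exists[OF K] by (auto simp: hilbert_basis_def orthonormal_def)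
  note bu = orthonormal_bessel[OF u(1)]
  let ?a = "analysis I u"
  have "hilbert_basis (ell2_ip I) N (?a ` B)"
    unfolding hilbert_basis_def
  proof (intro conjI ballI impI)
    show "?a ` B \<subseteq> N"
      using B(1) by (auto simp: N analysis_in_ell2[OF bu] synthesis_analysis[OF u(2)])
  next
    fix a b assume "a \<in> ?a ` B" "b \<in> ?a ` B"
    then obtain p q where pq: "p \<in> B" "q \<in> B" "a = ?a p" "b = ?a q" by blast
    have "?a p = ?a q \<longleftrightarrow> p = q" using synthesis_analysis[OF u(2)] by metis
    then show "ell2_ip I a b = (if a = b then 1 else 0)"
      using B(2) pq by (simp add: ell2_ip_analysis[OF u(2)] orthonormal_def)
  next
    fix c assume c: "c \<in> N" "\<forall>b\<in>?a ` B. ell2_ip I c b = 0"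
    have cE: "c \<in> ell2 I" using c(1) N by blast
    have "synthesis I u c = 0"
    proof (rule B(3))
      show "synthesis I u c \<in> K" using c(1) N by blast
      fix b assume "b \<in> B"
      then have "ell2_ip I c (?a b) = 0" using c(2) by blast
      then show "ip (synthesis I u c) b = 0"
        using ell2_ip_synthesis[OF u cE analysis_in_ell2[OF bu], of b]
        by (simp add: synthesis_analysis[OF u(2)])
    qed
    then have "c = ?a 0" using analysis_synthesis[OF u(1) cE] by simp
    then show "c = 0" by (auto simp: analysis_def)
  qed
  then show ?thesis by blast
qed

lemma ip_weak_R_dual:
  assumes "weak_R_dual scl ip I f u v w" "i \<in> I" "j \<in> I"
  shows "ip (w j) (v i) = ip (f i) (u j)"
proof -
  have "((\<lambda>k. ip (f k) (u j) * ip (v k) (v i)) has_sum ip (w j) (v i)) I"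
    using assms has_sum_ip_left[of "\<lambda>k. scl (ip (f k) (u j)) (v k)" I "w j" "v i"]
    by (simp add: weak_R_dual_def ip_scale_left)
  moreover have "((\<lambda>k. (ip (v k) (v i) - (if i = k then 1 else 0)) * ip (f k) (u j)) has_sum 0) I"
    using assms by (simp add: weak_R_dual_def gram_def)
  ultimately have "((\<lambda>k. ip (f k) (u j) * ip (v k) (v i)
      - (ip (v k) (v i) - (if i = k then 1 else 0)) * ip (f k) (u j)) has_sum ip (w j) (v i) - 0) I"
    by (rule has_sum_diff)
  then have "((\<lambda>k. (if i = k then 1 else 0) * ip (f k) (u j)) has_sum ip (w j) (v i)) I"
    by (simp add: algebra_simps)
  moreover have "((\<lambda>k. (if i = k then 1 else 0) * ip (f k) (u j)) has_sum ip (f i) (u j)) I"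
    by (rule has_sum_finite_neutralI[of "{i}"]) (use assms in auto)
  ultimately show ?thesis using has_sum_unique by blast
qed

lemma frame_bessel:
  assumes "is_frame ip I f"
  shows "\<exists>C. bessel I f C"
proof -
  obtain A C where AC: "0 < A" "A \<le> C" "frame_bounds ip I f A C"
    using assms by (auto simp: is_frame_def)
  have "bessel I f C"
    unfolding bessel_def
  proof (intro conjI allI impI)
    fix x F assume "finite F" "F \<subseteq> I"
    then have "(\<Sum>i\<in>F. (norm (ip x (f i)))\<^sup>2) \<le> (\<Sum>\<^sub>\<infinity>i\<in>I. (norm (ip x (f i)))\<^sup>2)"
      using AC(3) by (intro finite_sum_le_infsum) (auto simp: frame_bounds_def)
    also have "\<dots> \<le> C * (norm x)\<^sup>2" using AC(3) by (simp add: frame_bounds_def)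
    finally show "(\<Sum>i\<in>F. (norm (ip x (f i)))\<^sup>2) \<le> C * (norm x)\<^sup>2" .
  qed (use AC in simp)
  then show ?thesis ..
qed

end

lemma (in riesz_system) weak_R_dual_orthonormal:
  assumes wR: "weak_R_dual scl ip I f u v w"
  shows "orthonormal I u"
proof -
  have pu: "parseval_frame ip I u" and pv: "parseval_frame ip I v"
    using wR by (auto simp: weak_R_dual_def)
  note bu = parseval_frame_bessel[OF pu] and ru = parseval_frame_reconstructs[OF pu]
    and rv = parseval_frame_reconstructs[OF pv]
  have "ip (u k) (u i) = (if k = i then 1 else 0)" if i: "i \<in> I" and k: "k \<in> I" for i k
  proof -
    have "(\<lambda>k. (norm (ip (u k) (u i)))\<^sup>2) summable_on I"
      using bessel_coeff_summable[OF bu, of "u i"] by (simp only: norm_ip_sym[of "u i" "u _"])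
    from bessel_synthesis_summable[OF bessel_w this]
    obtain z where z: "((\<lambda>k. scl (ip (u k) (u i)) (w k)) has_sum z) I"
      by (auto simp: summable_on_def)
    have "ip z (v l) = ip (w i) (v l)" if l: "l \<in> I" for l
    proof -
      have "((\<lambda>k. ip (u k) (u i) * ip (w k) (v l)) has_sum ip z (v l)) I"
        using has_sum_ip_left[OF z] by (simp add: ip_scale_left)
      then have "((\<lambda>k. ip (f l) (u k) * ip (u k) (u i)) has_sum ip z (v l)) I"
        using ip_weak_R_dual[OF wR l] by (simp add: mult.commute cong: has_sum_cong)
      then have "ip z (v l) = ip (f l) (u i)"
        using reconstructs_ip[OF ru] has_sum_unique by blast
      then show ?thesis using ip_weak_R_dual[OF wR l i] by simp
    qed
    then have "((\<lambda>l. scl (ip (w i) (v l)) (v l)) has_sum z) I"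
      using rv[unfolded reconstructs_def, rule_format, of z] by (simp cong: has_sum_cong)
    then have "z = w i" using rv[unfolded reconstructs_def, rule_format, of "w i"] has_sum_unique by blast
    moreover have "((\<lambda>k. scl (if k = i then 1 else 0) (w k)) has_sum w i) I"
      by (rule has_sum_finite_neutralI[of "{i}"]) (use i in auto)
    ultimately have "((\<lambda>k. scl (ip (u k) (u i) - (if k = i then 1 else 0)) (w k)) has_sum 0) I"
      using has_sum_diff[OF z, of "\<lambda>k. scl (if k = i then 1 else 0) (w k)" "w i"]
      by (simp add: scale_left_diff_distrib)
    from coeff_eq_0[OF this k] show ?thesis by (simp only: eq_iff_diff_eq_0[symmetric])
  qed
  then show ?thesis by (simp add: orthonormal_def)
qed

lemma (in riesz_system) R_dual_of_weak_R_dual: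
  assumes sep: "countable D" "closure D = (UNIV::'h set)"
    and fC: "bessel I f C"
    and wR: "weak_R_dual scl ip I f u v w"
    and y: "\<And>i. i \<in> I \<Longrightarrow>
      y i = (\<Sum>\<^sub>\<infinity>k\<in>I. scl (ip (u k) (f i)) (canonical_dual scl ip I w k))"
    and dim: "hilbert_dim (ell2_ip I) (ker_synthesis scl I y) =
      hilbert_dim ip (orth_compl ip (span (w ` I)))"
  shows "orthonormal_basis scl ip I u \<and>
    (\<exists>v'. orthonormal_basis scl ip I v' \<and> R_dual scl ip I f u v' w)"
proof -
  have pu: "parseval_frame ip I u" and pv: "parseval_frame ip I v"
    and fu: "\<And>j. j \<in> I \<Longrightarrow> (\<lambda>i. (norm (ip (f i) (u j)))\<^sup>2) summable_on I"
    using wR by (auto simp: weak_R_dual_def)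
  have ou: "orthonormal I u" by (rule weak_R_dual_orthonormal[OF wR])
  have ru: "reconstructs I u" by (rule parseval_frame_reconstructs[OF pu])
  have rv: "reconstructs I v" by (rule parseval_frame_reconstructs[OF pv])
  note bu = parseval_frame_bessel[OF pu] and bv = parseval_frame_bessel[OF pv]
  interpret riesz_dual_system scl ip I w A B f u y C
    by unfold_locales (use fC bu y in auto)
  define V where "V = transfer I v u"
  have V_lin: "bounded_linear V" unfolding V_def by (rule transfer_bounded_linear[OF rv bv ou])
  have V_scl: "V (scl c x) = scl c (V x)" for c x unfolding V_def by (rule transfer_scl[OF bv bu])
  have V_ip: "ip (V x) (V z) = ip x z" for x z unfolding V_def by (rule transfer_ip[OF rv bv ou])
  have Vw: "ip (V (w j)) (u i) = ip (f i) (u j)" if "i \<in> I" "j \<in> I" for i j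
    unfolding V_def transfer_coeff[OF bv ou that(1)] by (rule ip_weak_R_dual[OF wR that])
  define K where "K = {z. \<forall>j\<in>I. ip z (V (w j)) = 0}"
  have K: "subspace K" unfolding K_def by (rule subspaceI) (auto simp: ip_add_left ip_scale_left)
  have ker: "c \<in> ker_synthesis scl I y \<longleftrightarrow> c \<in> ell2 I \<and> synthesis I u c \<in> K" for c
  proof (cases "c \<in> ell2 I")
    case True
    have "((\<lambda>i. c i * ip (u j) (f i)) has_sum 0) I \<longleftrightarrow> ip (synthesis I u c) (V (w j)) = 0"
      if j: "j \<in> I" for j
    proof -
      have "ip (u i) (V (w j)) = ip (u j) (f i)" if "i \<in> I" for i
        using Vw[OF that j] ip_sconj by metis
      then have "((\<lambda>i. c i * ip (u j) (f i)) has_sum ip (synthesis I u c) (V (w j))) I"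
        using has_sum_ip_left[OF synthesis_has_sum[OF bu True], of "V (w j)"]
        by (simp add: ip_scale_left cong: has_sum_cong)
      then show ?thesis using has_sum_unique by fastforce
    qed
    then show ?thesis using True by (simp add: ker_synthesis_iff K_def)
  qed (simp add: ker_synthesis_def)
  have compl: "orth_compl ip (span (w ` I)) = orth_compl ip W"
  proof
    show "orth_compl ip (span (w ` I)) \<subseteq> orth_compl ip W"
    proof
      fix x assume "x \<in> orth_compl ip (span (w ` I))"
      then have x: "ip s x = 0" if "s \<in> w ` I" for s
        using that span_base ip_eq_zero_sym by (auto simp: orth_compl_def)
      have "ip x s = 0" if "s \<in> W" for s
        by (rule ip_eq_zero_sym) (rule closed_span_ip_0[OF x that])
      then show "x \<in> orth_compl ip W" by (simp add: orth_compl_def)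
    qed
    show "orth_compl ip W \<subseteq> orth_compl ip (span (w ` I))"
      using closure_subset[of "span (w ` I)"] by (auto simp: orth_compl_def closed_span_def)
  qed
  define B1 where "B1 = (SOME S. hilbert_basis ip (orth_compl ip W) S)"
  define B2 where "B2 = (SOME S. hilbert_basis (ell2_ip I) (ker_synthesis scl I y) S)"
  have "subspace (orth_compl ip W)"
    by (rule subspaceI) (auto simp: orth_compl_def ip_add_left ip_scale_left)
  then have B1: "hilbert_basis ip (orth_compl ip W) B1"
    unfolding B1_def by (rule someI_ex[OF hilbert_basis_exists])
  have B2: "hilbert_basis (ell2_ip I) (ker_synthesis scl I y) B2"
    unfolding B2_def by (rule someI_ex[OF hilbert_basis_ell2_exists[OF ou ru K ker]])
  have o1: "orthonormal B1 (\<lambda>b. b)" using B1 by (simp add: hilbert_basis_def orthonormal_def)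
  have B2K: "c \<in> ell2 I" "synthesis I u c \<in> K" if "c \<in> B2" for c
    using B2 that ker unfolding hilbert_basis_def by auto
  have o2: "ip (synthesis I u c) (synthesis I u d) = (if c = d then 1 else 0)"
    if "c \<in> B2" "d \<in> B2" for c d
    using B2 that ell2_ip_synthesis[OF ou ru B2K(1) B2K(1)] by (simp add: hilbert_basis_def)
  have "inj_on (synthesis I u) B2"
    by (rule inj_on_inverseI[of _ "analysis I u"]) (simp add: analysis_synthesis[OF ou] B2K)
  moreover have "countable (synthesis I u ` B2)"
  proof (rule countable_orthonormal[OF sep])
    show "orthonormal (synthesis I u ` B2) (\<lambda>b. b)"
      using o2 inj_on_eq_iff[OF calculation] by (auto simp: orthonormal_def)
  qed
  ultimately have c2: "countable B2" using countable_image_inj_on by blast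
  have c1: "countable B1" by (rule countable_orthonormal[OF sep o1])
  obtain h where h: "bij_betw h B1 B2"
    using ex_bij_betw_if_enat_card_eq[OF _ c1 c2] dim
    unfolding compl hilbert_dim_def Let_def B1_def[symmetric] B2_def[symmetric] by metis
  define \<psi> where "\<psi> b = synthesis I u (h b)" for b
  have hB: "h b \<in> B2" if "b \<in> B1" for b using h that by (rule bij_betw_apply)
  have psi: "orthonormal B1 \<psi>"
    unfolding orthonormal_def \<psi>_def
    using o2 hB bij_betw_imp_inj_on[OF h] by (auto simp: inj_on_eq_iff)
  have Vclosed: "ip (V x) z = 0" if z: "\<And>j. j \<in> I \<Longrightarrow> ip (V (w j)) z = 0" and x: "x \<in> W" for x z
  proof -
    have "closed {x. ip (V x) z = 0}"
      by (intro closed_Collect_eq continuous_intros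
          continuous_on_compose2[OF continuous_ip_left[of UNIV z] linear_continuous_on[OF V_lin]]) auto
    moreover have "subspace {x. ip (V x) z = 0}"
      by (rule subspaceI)
         (auto simp: V_scl linear_simps[OF V_lin] ip_add_left ip_scale_left)
    moreover have "w ` I \<subseteq> {x. ip (V x) z = 0}" using z by auto
    ultimately show ?thesis using closed_span_minimal x by blast
  qed
  have "\<exists>v'. orthonormal_basis scl ip I v' \<and>
    (\<forall>x\<in>W. ((\<lambda>i. scl (ip (V x) (u i)) (v' i)) has_sum x) I)"
  proof (rule unitary_extension[OF closed_closed_span subspace_closed_span V_lin V_scl V_ip B1 psi])
    show "ip (V x) (\<psi> b) = 0" if "x \<in> W" "b \<in> B1" for x b
    proof (rule Vclosed[OF _ that(1)])
      show "ip (V (w j)) (\<psi> b) = 0" if "j \<in> I" for j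
        using B2K(2)[OF hB[OF \<open>b \<in> B1\<close>]] that ip_eq_zero_sym by (auto simp: K_def \<psi>_def)
    qed
    show "z = 0" if z: "\<And>x. x \<in> W \<Longrightarrow> ip (V x) z = 0" "\<And>b. b \<in> B1 \<Longrightarrow> ip z (\<psi> b) = 0" for z
    proof -
      have "z \<in> K" unfolding K_def using z(1)[OF w_in_W] ip_eq_zero_sym by blast
      then have ak: "analysis I u z \<in> ker_synthesis scl I y"
        by (simp add: ker analysis_in_ell2[OF bu] synthesis_analysis[OF ru])
      have "ell2_ip I (analysis I u z) c = 0" if c: "c \<in> B2" for c
      proof -
        obtain b where b: "b \<in> B1" "c = h b" using c h unfolding bij_betw_def by blast
        then show ?thesis
          using z(2)[OF b(1)] ell2_ip_synthesis[OF ou ru analysis_in_ell2[OF bu] B2K(1)[OF c], of z]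
          by (simp add: \<psi>_def synthesis_analysis[OF ru])
      qed
      then have "analysis I u z = 0" using B2 ak unfolding hilbert_basis_def by blast
      then have "synthesis I u (analysis I u z) = 0" by (simp add: synthesis_def)
      then show "z = 0" by (simp add: synthesis_analysis[OF ru])
    qed
  qed (rule ou, rule ru)
  then obtain v' where v': "orthonormal_basis scl ip I v'"
    "\<And>x. x \<in> W \<Longrightarrow> ((\<lambda>i. scl (ip (V x) (u i)) (v' i)) has_sum x) I" by blast
  have bu': "orthonormal_basis scl ip I u" by (rule reconstructs_orthonormal_basis[OF ou ru])
  have "((\<lambda>i. scl (ip (f i) (u j)) (v' i)) has_sum w j) I" if j: "j \<in> I" for j
    using v'(2)[OF w_in_W[OF j]] Vw[OF _ j] by (simp cong: has_sum_cong)
  then show ?thesis using bu' v'(1) fu by (auto simp: R_dual_def)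
qed

theorem theorem4p1:
  fixes scl :: "'k::rc_field \<Rightarrow> 'h::banach \<Rightarrow> 'h"
    and ip :: "'h \<Rightarrow> 'h \<Rightarrow> 'k"
    and I :: "'i set"
    and w f u v y :: "'i \<Rightarrow> 'h"
  assumes "hilbert_space scl ip"
    and "\<exists>D::'h set. countable D \<and> closure D = UNIV"
    and "hilbert_dim ip (UNIV :: 'h set) = \<infinity>"
    and "countable I"
    and "riesz_sequence scl I w"
    and "is_frame ip I f"
    and "parseval_frame ip I u"
    and "parseval_frame ip I v"
    and "weak_R_dual scl ip I f u v w"
    and "\<And>i. i \<in> I \<Longrightarrow>
      y i = (\<Sum>\<^sub>\<infinity>k\<in>I. scl (ip (u k) (f i)) (canonical_dual scl ip I w k))"
    and "hilbert_dim (ell2_ip I) (ker_synthesis scl I y) =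
      hilbert_dim ip (orth_compl ip (module.span scl (w ` I)))"
  shows "orthonormal_basis scl ip I u \<and>
    (\<exists>v'. orthonormal_basis scl ip I v' \<and> R_dual scl ip I f u v' w)"
proof -
  interpret hilbert_space scl ip by fact
  obtain D :: "'h set" where D: "countable D" "closure D = UNIV" using assms(2) by blast
  obtain A B where "0 < A" "A \<le> B" and AB: "\<forall>F c. finite F \<and> F \<subseteq> I \<longrightarrow>
        A * (\<Sum>j\<in>F. (norm (c j))\<^sup>2) \<le> (norm (\<Sum>j\<in>F. scl (c j) (w j)))\<^sup>2 \<and>
        (norm (\<Sum>j\<in>F. scl (c j) (w j)))\<^sup>2 \<le> B * (\<Sum>j\<in>F. (norm (c j))\<^sup>2)"
    using assms(5) unfolding riesz_sequence_def by blast
  then interpret riesz_system scl ip I w A B by unfold_locales auto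
  obtain C where "bessel I f C" using frame_bessel[OF assms(6)] by blast
  then show ?thesis by (rule R_dual_of_weak_R_dual[OF D _ assms(9-11)])
qed

end
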